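(* Let $X$ be an orientable small cover of dimension $n$ and let $G\subset\mathbb{Z}_2^n$ be the $2$-subtorus in general position. Then the orbit space $X/G$ is homeomorphic to the $n$-dimensional sphere $S^n$.
   Context: $\mathbb{Z}_2$ is the group with two elements. All actions are smooth. Small cover: let $P$ be a simple polytope of dimension $n$. A small cover over $P$ is a smooth (closed, connected) $n$-manifold $X$ with a locally standard $\mathbb{Z}_2^n$-action (locally modelled, up to an automorphism of $\mathbb{Z}_2^n$, on the coordinatewise sign action of $\{\pm1\}^n$ on $\mathbb{R}^n$) such that the orbit space $X/\mathbb{Z}_2^n$ is diffeomorphic to $P$ as a manifold with corners. General position: let $\mathbb{Z}_2^{n-1}$ act on an $n$-manifold $X$. For a fixed point $x$, the tangent representation on $T_xX$ decomposes as a sum of $n$ one-dimensional real representations $V(\alpha_{x,j})$, $t\cdot y=\alpha_{x,j}(t)y$, with $\alpha_{x,j}\in\operatorname{Hom}(\mathbb{Z}_2^{n-1},\{\pm1\})\cong\mathbb{Z}_2^{n-1}$, called the weights at $x$. The action is in general position if for every fixed point $x$ any $n-1$ of the $n$ weights $\alpha_{x,1},\dots,\alpha_{x,n}$ are linearly independent over $\mathbb{Z}_2$. $2$-subtorus in general position: a subgroup $G\cong\mathbb{Z}_2^{n-1}$ of $\mathbb{Z}_2^n$ of index $2$ such that the restricted action of $G$ on the small cover $X$ is in general position. For an orientable small cover such a subgroup exists and is unique. *)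

theory Defs
  imports "HOL-Analysis.Analysis" "HOL-Library.Z2"
begin

text \<open>
  The dimension \<open>n\<close> is \<open>CARD('n)\<close> for a finite index type \<open>'n\<close>. The group
  \<open>\<int>\<^sub>2\<^sup>n\<close> is the additive group of \<open>bit ^ 'n\<close>, where \<open>bit\<close> is the field with two elements.
\<close>

section \<open>Smooth maps between subsets of Euclidean spaces\<close>

text \<open>\<open>Ck_on k f S\<close> is the usual notion of a \<open>C\<^sup>k\<close> map only for open \<open>S\<close>.\<close>

primrec Ck_on ::
  "nat \<Rightarrow> ('b::real_normed_vector \<Rightarrow> 'c::real_normed_vector) \<Rightarrow> 'b set \<Rightarrow> bool" where
  "Ck_on 0 f S \<longleftrightarrow> continuous_on S f"
| "Ck_on (Suc k) f S \<longleftrightarrow>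
     (\<forall>x\<in>S. f differentiable (at x)) \<and> (\<forall>v. Ck_on k (\<lambda>x. frechet_derivative f (at x) v) S)"

text \<open>
  On an arbitrary subset, smooth means: locally the restriction of a smooth map defined on an
  open set of the ambient space. This is the convention used for manifolds with corners.
\<close>

definition smooth_on ::
  "'b::real_normed_vector set \<Rightarrow> ('b \<Rightarrow> 'c::real_normed_vector) \<Rightarrow> bool" where
  "smooth_on S f \<longleftrightarrow>
     (\<forall>x\<in>S. \<exists>U g. open U \<and> x \<in> U \<and> (\<forall>k. Ck_on k g U) \<and> (\<forall>y\<in>S \<inter> U. f y = g y))"


section \<open>Smooth manifolds and manifolds with corners\<close>

text \<open>
  A chart is a pair of its domain and its coordinate map. The set \<open>M\<close> is the local model:
  \<open>UNIV\<close> for manifolds without boundary, \<open>orthant\<close> for manifolds with corners.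
\<close>

type_synonym ('a, 'n) chart = "'a set \<times> ('a \<Rightarrow> real ^ 'n)"

definition orthant :: "(real ^ 'n::finite) set" where
  "orthant = {v. \<forall>i. 0 \<le> v $ i}"

definition is_chart :: "(real ^ 'n::finite) set \<Rightarrow> 'a topology \<Rightarrow> ('a, 'n::finite) chart \<Rightarrow> bool" where
  "is_chart M X = (\<lambda>(U, \<phi>).
     openin X U \<and> openin (top_of_set M) (\<phi> ` U) \<and>
     homeomorphic_map (subtopology X U) (top_of_set (\<phi> ` U)) \<phi>)"

definition transition :: "('a, 'n::finite) chart \<Rightarrow> ('a, 'n) chart \<Rightarrow> real ^ 'n \<Rightarrow> real ^ 'n" where
  "transition c d = snd d \<circ> inv_into (fst c) (snd c)"

definition compatible :: "('a, 'n::finite) chart \<Rightarrow> ('a, 'n) chart \<Rightarrow> bool" where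
  "compatible c d \<longleftrightarrow>
     smooth_on (snd c ` (fst c \<inter> fst d)) (transition c d) \<and>
     smooth_on (snd d ` (fst c \<inter> fst d)) (transition d c)"

definition smooth_atlas ::
  "(real ^ 'n::finite) set \<Rightarrow> 'a topology \<Rightarrow> ('a, 'n::finite) chart set \<Rightarrow> bool" where
  "smooth_atlas M X A \<longleftrightarrow>
     (\<forall>c\<in>A. is_chart M X c) \<and> \<Union>(fst ` A) = topspace X \<and> (\<forall>c\<in>A. \<forall>d\<in>A. compatible c d)"

text \<open>The maximal atlas of the smooth structure given by an atlas \<open>A\<close>, without boundary.\<close>

definition charts_of :: "'a topology \<Rightarrow> ('a, 'n::finite) chart set \<Rightarrow> ('a, 'n) chart set" where
  "charts_of X A = {c. is_chart UNIV X c \<and> (\<forall>d\<in>A. compatible c d)}"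

definition smooth_manifold :: "'a topology \<Rightarrow> ('a, 'n::finite) chart set \<Rightarrow> bool" where
  "smooth_manifold X A \<longleftrightarrow>
     Hausdorff_space X \<and> second_countable X \<and> smooth_atlas UNIV X A"

definition smooth_map ::
  "'a topology \<Rightarrow> ('a, 'n::finite) chart set \<Rightarrow> 'b topology \<Rightarrow> ('b, 'm::finite) chart set \<Rightarrow> ('a \<Rightarrow> 'b) \<Rightarrow> bool" where
  "smooth_map X A Y B f \<longleftrightarrow>
     continuous_map X Y f \<and>
     (\<forall>(U, \<phi>)\<in>A. \<forall>(V, \<psi>)\<in>B. smooth_on (\<phi> ` {x \<in> U. f x \<in> V}) (\<psi> \<circ> f \<circ> inv_into U \<phi>))"

definition diffeomorphism ::
  "'a topology \<Rightarrow> ('a, 'n::finite) chart set \<Rightarrow> 'b topology \<Rightarrow> ('b, 'n) chart set \<Rightarrow> ('a \<Rightarrow> 'b) \<Rightarrow> bool" where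
  "diffeomorphism X A Y B f \<longleftrightarrow>
     homeomorphic_map X Y f \<and> smooth_map X A Y B f \<and>
     smooth_map Y B X A (inv_into (topspace X) f)"

definition orientable :: "'a topology \<Rightarrow> ('a, 'n::finite) chart set \<Rightarrow> bool" where
  "orientable X A \<longleftrightarrow>
     (\<exists>B\<subseteq>charts_of X A. \<Union>(fst ` B) = topspace X \<and>
        (\<forall>c\<in>B. \<forall>d\<in>B. \<forall>x\<in>fst c \<inter> fst d.
           det (matrix (frechet_derivative (transition c d) (at (snd c x)))) > 0))"


section \<open>Actions of \<open>\<int>\<^sub>2\<^sup>n\<close> and orbit spaces\<close>

definition smooth_action ::
  "'a topology \<Rightarrow> ('a, 'n::finite) chart set \<Rightarrow> (bit ^ 'n \<Rightarrow> 'a \<Rightarrow> 'a) \<Rightarrow> bool" where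
  "smooth_action X A act \<longleftrightarrow>
     (\<forall>x\<in>topspace X. act 0 x = x) \<and>
     (\<forall>s t. \<forall>x\<in>topspace X. act (s + t) x = act s (act t x)) \<and>
     (\<forall>t. smooth_map X A X A (act t))"

definition action_orbit :: "('g \<Rightarrow> 'a \<Rightarrow> 'a) \<Rightarrow> 'g set \<Rightarrow> 'a \<Rightarrow> 'a set" where
  "action_orbit act G x = (\<lambda>t. act t x) ` G"

text \<open>The set of orbits with the quotient topology.\<close>

definition orbit_space :: "'a topology \<Rightarrow> ('g \<Rightarrow> 'a \<Rightarrow> 'a) \<Rightarrow> 'g set \<Rightarrow> 'a set topology" where
  "orbit_space X act G = topology (\<lambda>W.
     W \<subseteq> action_orbit act G ` topspace X \<and>
     openin X {x \<in> topspace X. action_orbit act G x \<in> W})"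

lemma openin_orbit_space:
  "openin (orbit_space X act G) W \<longleftrightarrow>
     W \<subseteq> action_orbit act G ` topspace X \<and>
     openin X {x \<in> topspace X. action_orbit act G x \<in> W}"
proof -
  let ?q = "action_orbit act G"
  have "istopology (\<lambda>W. W \<subseteq> ?q ` topspace X \<and> openin X {x \<in> topspace X. ?q x \<in> W})"
    unfolding istopology_def
  proof (intro conjI allI impI; (elim conjE)?)
    fix S T
    assume "openin X {x \<in> topspace X. ?q x \<in> S}" "openin X {x \<in> topspace X. ?q x \<in> T}"
    then have "openin X ({x \<in> topspace X. ?q x \<in> S} \<inter> {x \<in> topspace X. ?q x \<in> T})"
      by (rule openin_Int)
    moreover have "{x \<in> topspace X. ?q x \<in> S} \<inter> {x \<in> topspace X. ?q x \<in> T} =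
        {x \<in> topspace X. ?q x \<in> S \<inter> T}"
      by auto
    ultimately show "openin X {x \<in> topspace X. ?q x \<in> S \<inter> T}"
      by simp
  next
    fix K
    assume K: "\<forall>S\<in>K. S \<subseteq> ?q ` topspace X \<and> openin X {x \<in> topspace X. ?q x \<in> S}"
    then show "\<Union>K \<subseteq> ?q ` topspace X"
      by auto
    have "openin X (\<Union>S\<in>K. {x \<in> topspace X. ?q x \<in> S})"
      using K by auto
    moreover have "(\<Union>S\<in>K. {x \<in> topspace X. ?q x \<in> S}) = {x \<in> topspace X. ?q x \<in> \<Union>K}"
      by auto
    ultimately show "openin X {x \<in> topspace X. ?q x \<in> \<Union>K}"
      by simp
  qed auto
  then show ?thesis
    unfolding orbit_space_def by (simp add: topology_inverse')
qed

lemma topspace_orbit_space: "topspace (orbit_space X act G) = action_orbit act G ` topspace X"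
proof
  show "topspace (orbit_space X act G) \<subseteq> action_orbit act G ` topspace X"
    using openin_orbit_space[of X act G] by (auto simp: topspace_def)
  have "{x \<in> topspace X. action_orbit act G x \<in> action_orbit act G ` topspace X} = topspace X"
    by auto
  then have "openin (orbit_space X act G) (action_orbit act G ` topspace X)"
    by (simp add: openin_orbit_space)
  then show "action_orbit act G ` topspace X \<subseteq> topspace (orbit_space X act G)"
    by (rule openin_subset)
qed

lemma quotient_map_orbit_space:
  "quotient_map X (orbit_space X act G) (action_orbit act G)"
  by (auto simp: quotient_map_def topspace_orbit_space openin_orbit_space)


section \<open>Small covers\<close>

definition simple_polytope :: "(real ^ 'n::finite) set \<Rightarrow> bool" where
  "simple_polytope P \<longleftrightarrow>
     polytope P \<and> aff_dim P = int CARD('n) \<and>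
     (\<forall>v. v extreme_point_of P \<longrightarrow> card {F. F facet_of P \<and> v \<in> F} = CARD('n))"

text \<open>The manifold-with-corners structure that a polytope inherits from the ambient space.\<close>

definition polytope_charts :: "(real ^ 'n::finite) set \<Rightarrow> (real ^ 'n, 'n::finite) chart set" where
  "polytope_charts P = {(V, \<psi>).
     is_chart orthant (top_of_set P) (V, \<psi>) \<and>
     smooth_on V \<psi> \<and> smooth_on (\<psi> ` V) (inv_into V \<psi>)}"

definition bit_sign :: "bit \<Rightarrow> real" where
  "bit_sign b = (if b = 0 then 1 else - 1)"

definition sign_action :: "bit ^ 'n::finite \<Rightarrow> real ^ 'n \<Rightarrow> real ^ 'n" where
  "sign_action t v = (\<chi> i. bit_sign (t $ i) * v $ i)"

text \<open>
  Invariant charts in which the action is the coordinatewise sign action up to an automorphism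
  \<open>\<theta>\<close> of the group.
\<close>

definition standard_charts ::
  "'a topology \<Rightarrow> ('a, 'n::finite) chart set \<Rightarrow> (bit ^ 'n \<Rightarrow> 'a \<Rightarrow> 'a) \<Rightarrow> ('a, 'n) chart set" where
  "standard_charts X A act = {(U, \<phi>). (U, \<phi>) \<in> charts_of X A \<and>
     (\<forall>t. act t ` U \<subseteq> U) \<and>
     (\<exists>\<theta>. bij \<theta> \<and> (\<forall>s t. \<theta> (s + t) = \<theta> s + \<theta> t) \<and>
        (\<forall>t. \<forall>x\<in>U. \<phi> (act t x) = sign_action (\<theta> t) (\<phi> x)))}"

definition locally_standard ::
  "'a topology \<Rightarrow> ('a, 'n::finite) chart set \<Rightarrow> (bit ^ 'n \<Rightarrow> 'a \<Rightarrow> 'a) \<Rightarrow> bool" where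
  "locally_standard X A act \<longleftrightarrow>
     (\<forall>x\<in>topspace X. \<exists>c\<in>standard_charts X A act. x \<in> fst c)"

text \<open>
  The orbit space of a locally standard action as a manifold with corners. The orbit map of the
  sign action on \<open>\<real>\<^sup>n\<close> is \<open>v \<mapsto> (v\<^sub>i\<^sup>2)\<^sub>i\<close>, with values in the orthant: the smooth functions on the
  orbit space are exactly those whose pullback is smooth, because smooth functions that are even
  in every coordinate are smooth functions of the squares. The squares of the coordinates do
  not depend on the representative chosen in an orbit.
\<close>

definition orbit_chart ::
  "(bit ^ 'n \<Rightarrow> 'a \<Rightarrow> 'a) \<Rightarrow> ('a, 'n::finite) chart \<Rightarrow> ('a set, 'n) chart" where
  "orbit_chart act = (\<lambda>(U, \<phi>).
     (action_orbit act UNIV ` U, \<lambda>b. \<chi> i. (\<phi> (SOME x. x \<in> b) $ i)\<^sup>2))"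

definition orbit_charts ::
  "'a topology \<Rightarrow> ('a, 'n::finite) chart set \<Rightarrow> (bit ^ 'n \<Rightarrow> 'a \<Rightarrow> 'a) \<Rightarrow> ('a set, 'n) chart set" where
  "orbit_charts X A act = orbit_chart act ` standard_charts X A act"

definition small_cover ::
  "(real ^ 'n::finite) set \<Rightarrow> 'a topology \<Rightarrow> ('a, 'n::finite) chart set \<Rightarrow> (bit ^ 'n \<Rightarrow> 'a \<Rightarrow> 'a) \<Rightarrow> bool" where
  "small_cover P X A act \<longleftrightarrow>
     smooth_manifold X A \<and> compact_space X \<and> connected_space X \<and>
     smooth_action X A act \<and> locally_standard X A act \<and>
     (\<exists>h. diffeomorphism (orbit_space X act UNIV) (orbit_charts X A act)
            (top_of_set P) (polytope_charts P) h)"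


section \<open>Weights and general position\<close>

text \<open>
  The differential of \<open>act t\<close> at a fixed point \<open>x\<close>, where the tangent space is identified
  with \<open>\<real>\<^sup>n\<close> by a chart around \<open>x\<close>.
\<close>

definition tangent_action ::
  "(bit ^ 'n \<Rightarrow> 'a \<Rightarrow> 'a) \<Rightarrow> ('a, 'n::finite) chart \<Rightarrow> 'a \<Rightarrow> bit ^ 'n \<Rightarrow> real ^ 'n \<Rightarrow> real ^ 'n" where
  "tangent_action act = (\<lambda>(U, \<phi>) x t.
     frechet_derivative (\<phi> \<circ> act t \<circ> inv_into U \<phi>) (at (\<phi> x)))"

text \<open>
  Characters are written additively: \<open>\<alpha> j :: bit ^ 'n \<Rightarrow> bit\<close>, considered on \<open>G\<close> only, stands
  for the homomorphism \<open>bit_sign \<circ> \<alpha> j\<close> from \<open>G\<close> to \<open>{1, -1}\<close>. The vectors \<open>b j\<close> span the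
  one-dimensional summands of the tangent representation.
\<close>

definition weights_at ::
  "'a topology \<Rightarrow> ('a, 'n::finite) chart set \<Rightarrow> (bit ^ 'n \<Rightarrow> 'a \<Rightarrow> 'a) \<Rightarrow> (bit ^ 'n) set \<Rightarrow> 'a \<Rightarrow>
     ('n \<Rightarrow> bit ^ 'n \<Rightarrow> bit) \<Rightarrow> bool" where
  "weights_at X A act G x \<alpha> \<longleftrightarrow>
     (\<forall>j. \<forall>s\<in>G. \<forall>t\<in>G. \<alpha> j (s + t) = \<alpha> j s + \<alpha> j t) \<and>
     (\<exists>c\<in>charts_of X A. x \<in> fst c \<and>
        (\<exists>b. inj b \<and> independent (range b) \<and>
           (\<forall>j. \<forall>t\<in>G. tangent_action act c x t (b j) = bit_sign (\<alpha> j t) *\<^sub>R b j)))"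

definition independent_characters ::
  "'g set \<Rightarrow> 'j set \<Rightarrow> ('j \<Rightarrow> 'g \<Rightarrow> bit) \<Rightarrow> bool" where
  "independent_characters G J \<alpha> \<longleftrightarrow>
     (\<forall>c. (\<forall>t\<in>G. (\<Sum>j\<in>J. c j * \<alpha> j t) = 0) \<longrightarrow> (\<forall>j\<in>J. c j = 0))"

definition general_position ::
  "'a topology \<Rightarrow> ('a, 'n::finite) chart set \<Rightarrow> (bit ^ 'n \<Rightarrow> 'a \<Rightarrow> 'a) \<Rightarrow> (bit ^ 'n) set \<Rightarrow> bool" where
  "general_position X A act G \<longleftrightarrow>
     (\<forall>x\<in>topspace X. (\<forall>t\<in>G. act t x = x) \<longrightarrow>
        (\<forall>\<alpha>. weights_at X A act G x \<alpha> \<longrightarrow>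
           (\<forall>J. card J = CARD('n) - 1 \<longrightarrow> independent_characters G J \<alpha>)))"

text \<open>The index of a subgroup is expressed as its number of cosets.\<close>

definition subtorus_in_general_position ::
  "'a topology \<Rightarrow> ('a, 'n::finite) chart set \<Rightarrow> (bit ^ 'n \<Rightarrow> 'a \<Rightarrow> 'a) \<Rightarrow> (bit ^ 'n) set \<Rightarrow> bool" where
  "subtorus_in_general_position X A act G \<longleftrightarrow>
     0 \<in> G \<and> (\<forall>s\<in>G. \<forall>t\<in>G. s + t \<in> G) \<and> (\<forall>t\<in>G. - t \<in> G) \<and>
     card (range (\<lambda>a. (+) a ` G)) = 2 \<and>
     general_position X A act G"

end

theory Submission
  imports Defs
begin

text \<open>
  Let \<open>p : X \<rightarrow> P\<close> be the orbit map of the whole group. The group \<open>\<int>\<^sub>2\<^sup>n/G\<close> of order two acts on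
  \<open>X/G\<close> with quotient \<open>P\<close>, and the proof shows that \<open>X/G\<close> is the double of \<open>P\<close>: two copies of
  the ball \<open>P\<close>, glued along the boundary, hence a sphere.

  Over the boundary of \<open>P\<close> the map \<open>X/G \<rightarrow> P\<close> is injective as soon as every point there has a
  stabilizer that is not contained in \<open>G\<close> (\<open>stabilizer_not_in_subtorus\<close>). At a fixed point the
  weights form a basis of the dual of \<open>\<int>\<^sub>2\<^sup>n\<close>, and general position forces the reflections, that
  is, the dual basis, to lie outside \<open>G\<close> (\<open>reflection_not_in_subtorus\<close>). For a point over the
  relative interior of a facet, the stabilizer has order two. It does not change along the
  segment from its image to a vertex of the facet, and over the vertex there is a fixed point, so
  the claim is carried over from the vertex (\<open>facet_reflection_not_in_subtorus\<close>). A general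
  boundary point is perturbed to such a point. This argument needs that the orbit structure of
  \<open>X\<close> matches the face structure of \<open>P\<close>: in a standard chart, the number of vanishing
  coordinates at \<open>x\<close> is the number of facets through \<open>p x\<close> (\<open>card_zero_set_eq_facets\<close>). Here the
  smoothness of the identification of \<open>X/\<int>\<^sub>2\<^sup>n\<close> with \<open>P\<close> enters. A diffeomorphism between open
  subsets of the orthant preserves the number of vanishing coordinates, since its differential
  maps tangent cones to tangent cones (\<open>card_zero_set_diffeo\<close>).

  Over the interior of \<open>P\<close> the map \<open>X/G \<rightarrow> P\<close> is a two-sheeted covering. It is trivial, because
  the interior is convex. In terms of \<open>X\<close> this means that there is a continuous sign \<open>\<sigma>\<close> on the
  part of \<open>X\<close> over the interior that is changed exactly by the elements outside \<open>G\<close>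
  (\<open>sign_section_ball\<close>). If \<open>P\<close> is identified with the unit ball, and \<open>p\<close> with a map \<open>\<pi>\<close> into it,
  then \<open>x \<mapsto> (\<pi> x, \<sigma> x \<cdot> (1 - |\<pi> x|\<^sup>2)\<^sup>1\<^sup>/\<^sup>2)\<close> maps \<open>X\<close> onto the sphere, and its fibres are the
  orbits of \<open>G\<close> (\<open>orbit_space_homeomorphic_nsphere\<close>). As \<open>X\<close> is compact, this is a quotient map.
\<close>

section \<open>Smooth maps between open subsets of the orthant\<close>

lemma smooth_on_extension_derivative:
  assumes "smooth_on S f" "x \<in> S"
  obtains U g g' where "open U" "x \<in> U" "\<And>y. y \<in> S \<inter> U \<Longrightarrow> f y = g y"
    "(g has_derivative g') (at x)"
proof -
  obtain U g where *: "open U" "x \<in> U" "\<And>k. Ck_on k g U" "\<And>y. y \<in> S \<inter> U \<Longrightarrow> f y = g y"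
    using assms unfolding smooth_on_def by meson
  have "Ck_on (Suc 0) g U" by (rule *(3))
  then have "g differentiable (at x)" using *(2) by simp
  then show ?thesis using * that frechet_derivative_works by blast
qed

text \<open>
  For a point of the orthant, \<open>card (zero_set w)\<close> is the codimension of the open face that
  contains it.
\<close>

definition zero_set :: "real ^ 'n \<Rightarrow> 'n set" where
  "zero_set w = {i. w $ i = 0}"

lemma openin_orthant_ray:
  fixes w v :: "real ^ 'n::finite"
  assumes D: "openin (top_of_set orthant) D" and w: "w \<in> D"
    and v: "\<And>i. w $ i = 0 \<Longrightarrow> 0 \<le> v $ i"
  shows "\<forall>\<^sub>F s in at_right 0. w + s *\<^sub>R v \<in> D"
proof -
  obtain T where T: "open T" "D = T \<inter> orthant"
    using D unfolding openin_open by (auto simp: Int_commute)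
  have t1: "((\<lambda>s. w + s *\<^sub>R v) \<longlongrightarrow> w + 0 *\<^sub>R v) (at_right (0::real))"
    by (intro tendsto_intros)
  then have e1: "\<forall>\<^sub>F s in at_right 0. w + s *\<^sub>R v \<in> T"
    using T w by (intro topological_tendstoD[OF t1]) auto
  have e2: "\<forall>\<^sub>F s in at_right 0. 0 \<le> (w + s *\<^sub>R v) $ i" for i
  proof (cases "w $ i = 0")
    case True
    have "\<forall>\<^sub>F s in at_right (0::real). 0 < s"
      by (simp add: eventually_at_filter)
    then show ?thesis
      using v[OF True] True by (auto elim!: eventually_mono)
  next
    case False
    then have "0 < w $ i" using w T by (auto simp: orthant_def less_le)
    moreover have "((\<lambda>s. (w + s *\<^sub>R v) $ i) \<longlongrightarrow> (w + 0 *\<^sub>R v) $ i) (at_right (0::real))"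
      by (intro tendsto_intros)
    ultimately have "\<forall>\<^sub>F s in at_right 0. 0 < (w + s *\<^sub>R v) $ i"
      by (intro order_tendstoD(1)) auto
    then show ?thesis by (auto elim!: eventually_mono)
  qed
  have "\<forall>\<^sub>F s in at_right 0. \<forall>i. 0 \<le> (w + s *\<^sub>R v) $ i"
    using e2 by (simp add: eventually_all_finite)
  with e1 show ?thesis
    by eventually_elim (auto simp: T orthant_def)
qed

text \<open>
  The tangent cone of the orthant at \<open>w\<close> consists of the vectors \<open>v\<close> with \<open>v\<^sub>i \<ge> 0\<close> whenever
  \<open>w\<^sub>i = 0\<close>. A differentiable map into the orthant sends it into the tangent cone at the image.
\<close>

lemma derivative_maps_tangent_cone:
  fixes w v :: "real ^ 'n::finite" and f g :: "real ^ 'n \<Rightarrow> real ^ 'n"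
  assumes D: "openin (top_of_set orthant) D" "w \<in> D" and f: "f ` D \<subseteq> orthant"
    and U: "open U" "w \<in> U" "\<And>y. y \<in> D \<inter> U \<Longrightarrow> f y = g y"
    and L: "(g has_derivative L) (at w)"
    and v: "\<And>i. w $ i = 0 \<Longrightarrow> 0 \<le> v $ i" and j: "f w $ j = 0"
  shows "0 \<le> L v $ j"
proof -
  have lin: "linear L" using L has_derivative_linear by blast
  have "((\<lambda>s. w + s *\<^sub>R v) has_derivative (\<lambda>s. s *\<^sub>R v)) (at (0::real))"
    by (auto intro!: derivative_eq_intros)
  moreover have "(g has_derivative L) (at (w + 0 *\<^sub>R v))" using L by simp
  ultimately have "((\<lambda>s. g (w + s *\<^sub>R v)) has_derivative (\<lambda>s. L (s *\<^sub>R v))) (at 0)"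
    using diff_chain_at[of "\<lambda>s. w + s *\<^sub>R v" "\<lambda>s. s *\<^sub>R v" 0 g L] by (simp add: o_def)
  then have "((\<lambda>s. g (w + s *\<^sub>R v) $ j) has_derivative (\<lambda>s. L (s *\<^sub>R v) $ j)) (at 0)"
    by (rule bounded_linear.has_derivative[OF bounded_linear_vec_nth])
  then have "((\<lambda>s. g (w + s *\<^sub>R v) $ j) has_real_derivative (L v $ j)) (at 0)"
    unfolding has_field_derivative_def
    by (rule has_derivative_eq_rhs) (auto simp: linear_scale[OF lin] mult.commute)
  then have "((\<lambda>s. (g (w + s *\<^sub>R v) $ j - g w $ j) / s) \<longlongrightarrow> L v $ j) (at_right 0)"
    unfolding has_field_derivative_iff by (auto intro: tendsto_mono[OF at_le])
  moreover have gw: "g w $ j = 0" using U(2,3) D(2) j by auto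
  have "\<forall>\<^sub>F s in at_right 0. 0 \<le> (g (w + s *\<^sub>R v) $ j - g w $ j) / s"
  proof -
    have t1: "((\<lambda>s. w + s *\<^sub>R v) \<longlongrightarrow> w + 0 *\<^sub>R v) (at_right (0::real))"
      by (intro tendsto_intros)
    have "\<forall>\<^sub>F s in at_right 0. w + s *\<^sub>R v \<in> D"
      by (rule openin_orthant_ray[OF D v])
    moreover have "\<forall>\<^sub>F s in at_right 0. w + s *\<^sub>R v \<in> U"
      using U(1,2) by (intro topological_tendstoD[OF t1]) auto
    moreover have "\<forall>\<^sub>F s in at_right (0::real). 0 < s"
      by (simp add: eventually_at_filter)
    ultimately show ?thesis
    proof eventually_elim
      case (elim s)
      then have "g (w + s *\<^sub>R v) \<in> orthant" using f U(3) by (metis IntI image_subset_iff)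
      then show ?case using elim gw by (auto simp: orthant_def)
    qed
  qed
  ultimately show ?thesis
    by (intro tendsto_lowerbound[where F = "at_right 0"]) auto
qed

lemma dim_vanishing:
  fixes I :: "'n::finite set"
  shows "dim {v :: real ^ 'n. \<forall>i\<in>I. v $ i = 0} + card I = CARD('n)"
proof -
  let ?d = "(\<lambda>i. axis i (1::real)) ` (- I) :: (real ^ 'n) set"
  have inj: "inj_on (\<lambda>i. axis i (1::real) :: real ^ 'n) A" for A
    by (auto simp: inj_on_def axis_eq_axis)
  have "dim {x :: real ^ 'n. \<forall>i\<in>Basis. i \<notin> ?d \<longrightarrow> x \<bullet> i = 0} = card ?d"
    by (rule dim_substandard) (auto simp: Basis_vec_def)
  moreover have "{x :: real ^ 'n. \<forall>i\<in>Basis. i \<notin> ?d \<longrightarrow> x \<bullet> i = 0} = {v. \<forall>i\<in>I. v $ i = 0}"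
    by (auto simp: Basis_vec_def inner_axis axis_eq_axis image_iff)
  moreover have "card ?d = card (- I)"
    by (rule card_image[OF inj])
  moreover have "card (- I) + card I = CARD('n)"
    using card_Un_disjoint[of "- I" I] by (simp add: Compl_partition2)
  ultimately show ?thesis by simp
qed

text \<open>
  The differential is injective and maps the largest linear subspace of the tangent cone at \<open>w\<close>
  into that of the tangent cone at \<open>f w\<close>. A comparison of dimensions gives the inequality.
\<close>

lemma card_zero_set_smooth_inverse_le:
  fixes f g :: "real ^ 'n::finite \<Rightarrow> real ^ 'n"
  assumes D: "openin (top_of_set orthant) D" and D': "openin (top_of_set orthant) D'"
    and f: "smooth_on D f" "f ` D \<subseteq> D'" and g: "smooth_on D' g"
    and gf: "\<And>x. x \<in> D \<Longrightarrow> g (f x) = x" and w: "w \<in> D"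
  shows "card (zero_set (f w)) \<le> card (zero_set w)"
proof -
  obtain U F L where F: "open U" "w \<in> U" "\<And>y. y \<in> D \<inter> U \<Longrightarrow> f y = F y"
    "(F has_derivative L) (at w)"
    using smooth_on_extension_derivative[OF f(1) w] by blast
  have fw: "f w \<in> D'" "F w = f w" using w f(2) F by auto
  obtain V E M where E: "open V" "f w \<in> V" "\<And>y. y \<in> D' \<inter> V \<Longrightarrow> g y = E y"
    "(E has_derivative M) (at (f w))"
    using smooth_on_extension_derivative[OF g fw(1)] by blast
  have ED: "((E \<circ> F) has_derivative (M \<circ> L)) (at w)"
    by (rule diff_chain_at) (use F E fw in auto)
  have Fw: "(F \<longlongrightarrow> F w) (at w)"
    using F(4) has_derivative_continuous isCont_def by blast
  have "\<forall>\<^sub>F y in at w. F y \<in> V"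
    using topological_tendstoD[OF Fw E(1)] E(2) fw by simp
  moreover have "\<forall>\<^sub>F y in at w. y \<in> U"
    using F(1,2) by (rule eventually_at_in_open')
  ultimately have ev: "\<forall>\<^sub>F y in at w. F y \<in> V \<and> y \<in> U"
    by (rule eventually_conj)
  \<comment> \<open>\<open>E \<circ> F\<close> is the identity on \<open>D\<close> only, but \<open>D\<close> contains a segment from \<open>w\<close> in each positive
    coordinate direction. This determines the derivative.\<close>
  have id: "((E \<circ> F) has_derivative (\<lambda>v. v)) (at w within D)"
  proof (rule has_derivative_transform_eventually[where f = "\<lambda>x. x"])
    have "\<forall>\<^sub>F y in at w within D. F y \<in> V \<and> y \<in> U"
      using ev by (rule filter_leD[OF at_le, rotated]) simp
    moreover have "\<forall>\<^sub>F y in at w within D. y \<in> D"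
      by (simp add: eventually_at_filter)
    ultimately show "\<forall>\<^sub>F y in at w within D. y = (E \<circ> F) y"
    proof eventually_elim
      case (elim y)
      then have "f y = F y" "f y \<in> D'" using F f(2) by auto
      then show ?case using elim E(3)[of "f y"] gf[of y] by auto
    qed
    show "w = (E \<circ> F) w" using fw E(2) E(3)[of "f w"] gf[OF w] by auto
  qed (auto simp: w)
  have "M \<circ> L = (\<lambda>v. v)"
  proof (rule frechet_derivative_unique_within[OF has_derivative_at_withinI[OF ED] id])
    fix i :: "real ^ 'n" and e :: real
    assume i: "i \<in> Basis" and e: "e > 0"
    have "\<forall>\<^sub>F s in at_right 0. w + s *\<^sub>R i \<in> D"
      using i by (intro openin_orthant_ray[OF D w]) (auto simp: Basis_vec_def axis_def)
    moreover have "\<forall>\<^sub>F s in at_right 0. 0 < s \<and> s < e"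
      using eventually_at_right_real[OF e] by (auto elim!: eventually_mono)
    ultimately have "\<forall>\<^sub>F s in at_right 0. w + s *\<^sub>R i \<in> D \<and> 0 < s \<and> s < e"
      by eventually_elim auto
    then obtain s where "w + s *\<^sub>R i \<in> D \<and> 0 < s \<and> s < e"
      using eventually_happens' trivial_limit_at_right_real by blast
    then show "\<exists>d. 0 < \<bar>d\<bar> \<and> \<bar>d\<bar> < e \<and> w + d *\<^sub>R i \<in> D"
      by (intro exI[of _ s]) auto
  qed
  then have inj: "inj L" by (metis comp_apply inj_on_inverseI)
  have lin: "linear L" using F(4) has_derivative_linear by blast
  have sub: "L ` {v. \<forall>i\<in>zero_set w. v $ i = 0} \<subseteq> {v. \<forall>i\<in>zero_set (f w). v $ i = 0}"
  proof clarsimp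
    fix v :: "real ^ 'n" and j assume v: "\<forall>i\<in>zero_set w. v $ i = 0" and j: "j \<in> zero_set (f w)"
    have fo: "f ` D \<subseteq> orthant" using f(2) openin_imp_subset[OF D'] by auto
    note cone = derivative_maps_tangent_cone[OF D w fo F(1,2) F(3) F(4)]
    \<comment> \<open>Both \<open>v\<close> and \<open>- v\<close> lie in the tangent cone.\<close>
    have "0 \<le> L v $ j" by (rule cone) (use v j in \<open>auto simp: zero_set_def\<close>)
    moreover have "0 \<le> L (- v) $ j" by (rule cone) (use v j in \<open>auto simp: zero_set_def\<close>)
    ultimately show "L v $ j = 0" by (simp add: linear_neg[OF lin])
  qed
  have "dim {v :: real ^ 'n. \<forall>i\<in>zero_set w. v $ i = 0} =
      dim (L ` {v. \<forall>i\<in>zero_set w. v $ i = 0})"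
    by (rule dim_image_eq[OF lin, symmetric]) (use inj in \<open>auto simp: inj_on_def\<close>)
  also have "\<dots> \<le> dim {v :: real ^ 'n. \<forall>i\<in>zero_set (f w). v $ i = 0}"
    by (rule dim_subset[OF sub])
  finally show ?thesis
    using dim_vanishing[of "zero_set w"] dim_vanishing[of "zero_set (f w)"] by linarith
qed

lemma card_zero_set_diffeo:
  fixes f g :: "real ^ 'n::finite \<Rightarrow> real ^ 'n"
  assumes "openin (top_of_set orthant) D" "openin (top_of_set orthant) D'"
    and "smooth_on D f" "f ` D \<subseteq> D'" "smooth_on D' g" "g ` D' \<subseteq> D"
    and "\<And>x. x \<in> D \<Longrightarrow> g (f x) = x" "\<And>x. x \<in> D' \<Longrightarrow> f (g x) = x" and w: "w \<in> D"
  shows "card (zero_set (f w)) = card (zero_set w)"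
proof (rule antisym)
  show "card (zero_set (f w)) \<le> card (zero_set w)"
    using card_zero_set_smooth_inverse_le[of D D' f g w] assms by auto
  have "f w \<in> D'" using assms by auto
  then have "card (zero_set (g (f w))) \<le> card (zero_set (f w))"
    using card_zero_set_smooth_inverse_le[of D' D g f "f w"] assms by auto
  then show "card (zero_set w) \<le> card (zero_set (f w))" using assms by simp
qed

section \<open>Charts of a simple polytope\<close>

text \<open>
  The facets themselves serve as indices of the half-spaces that define the polytope.
\<close>

lemma full_dimensional_polytope_halfspaces:
  fixes P :: "(real ^ 'n::finite) set"
  assumes P: "polytope P" and dim: "aff_dim P = int CARD('n)"
  obtains a :: "(real ^ 'n) set \<Rightarrow> real ^ 'n" and b :: "(real ^ 'n) set \<Rightarrow> real"
  where "finite {F. F facet_of P}"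
    and "P = {x. \<forall>F. F facet_of P \<longrightarrow> a F \<bullet> x \<le> b F}"
    and "interior P = {x. \<forall>F. F facet_of P \<longrightarrow> a F \<bullet> x < b F}"
    and "\<And>F. F facet_of P \<Longrightarrow> F = P \<inter> {x. a F \<bullet> x = b F}"
proof -
  have poly: "polyhedron P" and conv: "convex P"
    using P polytope_imp_polyhedron polytope_imp_convex by auto
  have aff: "affine hull P = UNIV"
    using dim aff_dim_eq_full[of P] by simp
  obtain H where H: "finite H" "P = affine hull P \<inter> \<Inter>H"
      "\<And>h. h \<in> H \<Longrightarrow> \<exists>a b. a \<noteq> 0 \<and> h = {x. a \<bullet> x \<le> b}"
      "\<And>H'. H' \<subset> H \<Longrightarrow> P \<subset> affine hull P \<inter> \<Inter>H'"
    using poly unfolding polyhedron_Int_affine_minimal by metis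
  obtain c d where cd: "\<And>h. h \<in> H \<Longrightarrow> c h \<noteq> (0 :: real ^ 'n) \<and> h = {x. c h \<bullet> x \<le> d h}"
    using H(3) by metis
  note facet = facet_of_polyhedron_explicit[OF H(1,2) cd H(4)]
  have mem: "x \<in> h \<longleftrightarrow> c h \<bullet> x \<le> d h" if "h \<in> H" for x h
    using cd[OF that] by blast
  have PH: "x \<in> P \<longleftrightarrow> (\<forall>h\<in>H. c h \<bullet> x \<le> d h)" for x
    using H(2) aff mem by auto
  have open_strict: "open {x. \<forall>h\<in>H. c h \<bullet> x < d h}"
  proof -
    have "{x. \<forall>h\<in>H. c h \<bullet> x < d h} = (\<Inter>h\<in>H. {x. c h \<bullet> x < d h})" by auto
    then show ?thesis using H(1) by (simp add: open_INT open_halfspace_lt)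
  qed
  have int: "interior P = {x. \<forall>h\<in>H. c h \<bullet> x < d h}"
  proof (rule antisym)
    show "interior P \<subseteq> {x. \<forall>h\<in>H. c h \<bullet> x < d h}"
    proof clarify
      fix x h assume x: "x \<in> interior P" and h: "h \<in> H"
      have "P \<subseteq> {x. c h \<bullet> x \<le> d h}" using PH h by auto
      then have "interior P \<subseteq> interior {x. c h \<bullet> x \<le> d h}" by (rule interior_mono)
      then show "c h \<bullet> x < d h" using x cd[OF h] interior_halfspace_le[of "c h" "d h"] by auto
    qed
    show "{x. \<forall>h\<in>H. c h \<bullet> x < d h} \<subseteq> interior P"
      by (rule interior_maximal[OF _ open_strict]) (use PH in \<open>auto intro: less_imp_le\<close>)
  qed
  have "P \<noteq> {}" using dim by auto
  then have "interior P \<noteq> {}"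
    using rel_interior_interior[OF aff] rel_interior_eq_empty[OF conv] by simp
  then obtain x0 where x0: "\<forall>h\<in>H. c h \<bullet> x0 < d h" using int by auto
  define fc where "fc h = P \<inter> {x. c h \<bullet> x = d h}" for h
  \<comment> \<open>If \<open>h\<close> and \<open>k\<close> define the same facet, drop \<open>h\<close>: by minimality some \<open>y\<close> outside \<open>P\<close> violates
    only \<open>h\<close>. The segment from an interior point to \<open>y\<close> meets the hyperplane of \<open>h\<close> in a point
    where the inequality of \<open>k\<close> is strict.\<close>
  have inj: "inj_on fc H"
  proof (rule inj_onI, rule ccontr)
    fix h k assume h: "h \<in> H" "k \<in> H" and eq: "fc h = fc k" and neq: "h \<noteq> k"
    have "H - {h} \<subset> H" using h by auto
    from H(4)[OF this] obtain y where y: "y \<in> \<Inter>(H - {h})" "y \<notin> P" by auto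
    then have y1: "c k \<bullet> y \<le> d k" if "k \<in> H" "k \<noteq> h" for k
      using that mem[of k y] by auto
    with y(2) PH have y2: "d h < c h \<bullet> y" by force
    define s where "s = (d h - c h \<bullet> x0) / (c h \<bullet> y - c h \<bullet> x0)"
    have s: "0 < s" "s < 1" "s * (c h \<bullet> y - c h \<bullet> x0) = d h - c h \<bullet> x0"
      using y2 x0 h unfolding s_def by (auto simp: field_simps)
    define z where "z = x0 + s *\<^sub>R (y - x0)"
    have zh: "c h \<bullet> z = d h"
      using s(3) by (simp add: z_def inner_right_distrib inner_diff_right)
    have zk: "c k \<bullet> z < d k" if "k \<in> H" "k \<noteq> h" for k
    proof -
      have "c k \<bullet> z = (1 - s) * (c k \<bullet> x0) + s * (c k \<bullet> y)"
        by (simp add: z_def inner_right_distrib inner_diff_right algebra_simps)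
      also have "\<dots> < (1 - s) * d k + s * d k"
        using s x0 y1[OF that] that(1) by (intro add_less_le_mono mult_strict_left_mono) auto
      finally show ?thesis by (simp add: algebra_simps)
    qed
    have "c k \<bullet> z \<le> d k" if "k \<in> H" for k
      using zh zk[OF that] by (cases "k = h") auto
    then have "z \<in> fc h" unfolding fc_def using zh PH by auto
    moreover have "z \<notin> fc k" using zk[of k] h neq by (auto simp: fc_def)
    ultimately show False using eq by simp
  qed
  have facets: "{F. F facet_of P} = fc ` H"
    using facet by (auto simp: fc_def)
  have inv: "inv_into H fc (fc h) = h" if "h \<in> H" for h
    using inj that by simp
  show thesis
  proof (rule that[of "c \<circ> inv_into H fc" "d \<circ> inv_into H fc"])
    show "finite {F. F facet_of P}" using facets H(1) by simp
    have all: "(\<forall>F. F facet_of P \<longrightarrow> Q F) \<longleftrightarrow> (\<forall>h\<in>H. Q (fc h))" for Q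
    proof -
      have "(\<forall>F. F facet_of P \<longrightarrow> Q F) \<longleftrightarrow> (\<forall>F\<in>{F. F facet_of P}. Q F)" by simp
      then show ?thesis unfolding facets by simp
    qed
    have "P = {x. \<forall>h\<in>H. c (inv_into H fc (fc h)) \<bullet> x \<le> d (inv_into H fc (fc h))}"
      using PH by (simp add: inv set_eq_iff)
    then show "P = {x. \<forall>F. F facet_of P \<longrightarrow> (c \<circ> inv_into H fc) F \<bullet> x \<le> (d \<circ> inv_into H fc) F}"
      unfolding all by simp
    have "interior P = {x. \<forall>h\<in>H. c (inv_into H fc (fc h)) \<bullet> x < d (inv_into H fc (fc h))}"
      using int by (simp add: inv)
    then show "interior P = {x. \<forall>F. F facet_of P \<longrightarrow> (c \<circ> inv_into H fc) F \<bullet> x < (d \<circ> inv_into H fc) F}"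
      unfolding all by simp
    fix F assume "F facet_of P"
    then have "F \<in> fc ` H" using facets by blast
    then obtain h where h: "h \<in> H" "F = fc h" by blast
    have "fc h = P \<inter> {x. (c \<circ> inv_into H fc) (fc h) \<bullet> x = (d \<circ> inv_into H fc) (fc h)}"
      unfolding comp_def inv[OF h(1)] by (rule fc_def)
    then show "F = P \<inter> {x. (c \<circ> inv_into H fc) F \<bullet> x = (d \<circ> inv_into H fc) F}"
      unfolding h(2) .
  qed
qed

lemma Ck_on_const: "Ck_on k (\<lambda>x. c) U"
  by (induction k arbitrary: c) auto

lemma Ck_on_affine:
  assumes "bounded_linear L"
  shows "Ck_on k (\<lambda>x. L x + c) U"
proof (cases k)
  case 0
  then show ?thesis
    using assms linear_continuous_on[of L U] by (auto intro!: continuous_on_add continuous_on_const)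
next
  case (Suc m)
  have d: "((\<lambda>x. L x + c) has_derivative L) (at x)" for x
    by (auto intro!: derivative_eq_intros bounded_linear_imp_has_derivative assms)
  have "frechet_derivative (\<lambda>x. L x + c) (at x) = L" for x
    using frechet_derivative_at[OF d] by simp
  then show ?thesis
    using d Suc by (auto simp: Ck_on_const differentiable_def)
qed

lemma smooth_on_affine:
  assumes "bounded_linear L" "\<And>x. x \<in> S \<Longrightarrow> f x = L x + c"
  shows "smooth_on S f"
  unfolding smooth_on_def
proof
  fix x assume "x \<in> S"
  show "\<exists>U g. open U \<and> x \<in> U \<and> (\<forall>k. Ck_on k g U) \<and> (\<forall>y\<in>S \<inter> U. f y = g y)"
    by (rule exI[of _ UNIV], rule exI[of _ "\<lambda>x. L x + c"])
      (use assms Ck_on_affine in auto)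
qed

text \<open>
  Near a vertex \<open>v\<close> a simple polytope looks like the orthant: the coordinates are the slacks
  \<open>b\<^sub>F - a\<^sub>F \<bullet> x\<close> of the \<open>n\<close> facets \<open>F\<close> through \<open>v\<close>. They are affine coordinates, since otherwise \<open>P\<close>
  would contain a segment with midpoint \<open>v\<close>. The chart is defined away from the facets that do
  not contain \<open>v\<close>.
\<close>

lemma simple_polytope_vertex_chart:
  fixes P :: "(real ^ 'n::finite) set"
  assumes P: "simple_polytope P" and v: "v extreme_point_of P"
  defines "V \<equiv> {q \<in> P. \<forall>F. F facet_of P \<longrightarrow> q \<in> F \<longrightarrow> v \<in> F}"
  obtains \<psi> where "(V, \<psi>) \<in> polytope_charts P"
    and "\<And>q. q \<in> V \<Longrightarrow> card (zero_set (\<psi> q)) = card {F. F facet_of P \<and> q \<in> F}"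
proof -
  have pd: "polytope P" "aff_dim P = int CARD('n)"
    using P by (auto simp: simple_polytope_def)
  obtain a :: "(real ^ 'n) set \<Rightarrow> real ^ 'n" and b :: "(real ^ 'n) set \<Rightarrow> real"
  where fin: "finite {F. F facet_of P}"
    and P_eq: "P = {x. \<forall>F. F facet_of P \<longrightarrow> a F \<bullet> x \<le> b F}"
    and int: "interior P = {x. \<forall>F. F facet_of P \<longrightarrow> a F \<bullet> x < b F}"
    and F_eq: "\<And>F. F facet_of P \<Longrightarrow> F = P \<inter> {x. a F \<bullet> x = b F}"
    by (rule full_dimensional_polytope_halfspaces[OF pd]) (rule that)
  have mem_P: "x \<in> P \<longleftrightarrow> (\<forall>F. F facet_of P \<longrightarrow> a F \<bullet> x \<le> b F)" for x
    using P_eq by blast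
  have mem_F: "x \<in> F \<longleftrightarrow> a F \<bullet> x = b F" if "F facet_of P" "x \<in> P" for F x
    using F_eq[OF that(1)] that(2) by blast
  have vP: "v \<in> P" using v by (simp add: extreme_point_of_def)
  define Fv where "Fv = {F. F facet_of P \<and> v \<in> F}"
  have "card Fv = CARD('n)" using P v unfolding simple_polytope_def Fv_def by blast
  moreover have "finite Fv" using fin unfolding Fv_def by (rule rev_finite_subset) auto
  ultimately obtain e :: "'n \<Rightarrow> (real ^ 'n) set" where e: "bij_betw e UNIV Fv"
    by (metis finite_class.finite_UNIV finite_same_card_bij)
  have eF: "e i facet_of P" "v \<in> e i" for i
    using e unfolding Fv_def bij_betw_def by auto
  have ex_e: "\<exists>i. F = e i" if "F facet_of P" "v \<in> F" for F
    using e that unfolding Fv_def bij_betw_def by (auto simp: image_iff set_eq_iff)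
  define W where "W = {x. \<forall>F. F facet_of P \<longrightarrow> v \<notin> F \<longrightarrow> a F \<bullet> x < b F}"
  have W: "open W"
  proof -
    have "W = (\<Inter>F\<in>{F. F facet_of P} - Fv. {x. a F \<bullet> x < b F})"
      by (auto simp: W_def Fv_def)
    then show ?thesis using fin by (simp add: open_INT open_halfspace_lt)
  qed
  define L :: "real ^ 'n \<Rightarrow> real ^ 'n" where "L x = (\<chi> i. a (e i) \<bullet> x)" for x
  define \<beta> :: "real ^ 'n" where "\<beta> = (\<chi> i. b (e i))"
  define \<psi> where "\<psi> x = \<beta> - L x" for x
  have linL: "linear L"
    by (rule linearI) (auto simp: L_def inner_right_distrib vec_eq_iff)
  have \<psi>_nth: "\<psi> x $ i = b (e i) - a (e i) \<bullet> x" for x i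
    by (simp add: \<psi>_def L_def \<beta>_def)
  have V_W: "V = {x \<in> W. \<psi> x \<in> orthant}"
  proof (intro set_eqI iffI)
    fix x assume x: "x \<in> V"
    then have xP: "x \<in> P" by (simp add: V_def)
    have "x \<in> W" unfolding W_def
    proof clarify
      fix F assume F: "F facet_of P" "v \<notin> F"
      then have "x \<notin> F" using x by (auto simp: V_def)
      then show "a F \<bullet> x < b F" using mem_F[OF F(1) xP] F xP mem_P by (auto simp: less_le)
    qed
    moreover have "\<psi> x \<in> orthant"
      using xP mem_P eF by (auto simp: orthant_def \<psi>_nth)
    ultimately show "x \<in> {x \<in> W. \<psi> x \<in> orthant}" by simp
  next
    fix x assume x: "x \<in> {x \<in> W. \<psi> x \<in> orthant}"
    have le: "a F \<bullet> x \<le> b F" if F: "F facet_of P" for F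
    proof (cases "v \<in> F")
      case True
      then obtain i where "F = e i" using ex_e F by auto
      moreover have "0 \<le> \<psi> x $ i" using x by (simp add: orthant_def)
      ultimately show ?thesis using \<psi>_nth[of x i] by simp
    next
      case False
      then show ?thesis using x F by (auto simp: W_def less_imp_le)
    qed
    then have xP: "x \<in> P" using mem_P by blast
    show "x \<in> V" unfolding V_def
    proof (clarsimp simp: xP)
      fix F assume F: "F facet_of P" "x \<in> F"
      show "v \<in> F"
      proof (rule ccontr)
        assume "v \<notin> F"
        then have "a F \<bullet> x < b F" using x F by (auto simp: W_def)
        then show False using mem_F[OF F(1) xP] F(2) by simp
      qed
    qed
  qed
  have vV: "v \<in> V" by (simp add: V_def vP)
  have \<psi>v: "\<psi> v = 0"
    using mem_F vP eF by (auto simp: vec_eq_iff \<psi>_nth)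
  have "inj L"
  proof (rule linear_injective_0[THEN iffD2, OF linL], clarify, rule ccontr)
    fix w assume Lw: "L w = 0" and w: "w \<noteq> 0"
    have "v \<in> W" using vV V_W by auto
    then obtain r where r: "r > 0" "ball v r \<subseteq> W" using W open_contains_ball by blast
    define u where "u = (r / (2 * norm w)) *\<^sub>R w"
    have u: "u \<noteq> 0" "norm u < r" using r w by (auto simp: u_def)
    have Lu: "L u = 0" using Lw by (simp add: u_def linear_scale[OF linL])
    have "v + u \<in> W" "v - u \<in> W" using u r by (auto simp: subset_iff dist_norm)
    moreover have "\<psi> (v + u) = 0" "\<psi> (v - u) = 0"
      using \<psi>v Lu by (auto simp: \<psi>_def linear_add[OF linL] linear_diff[OF linL])
    ultimately have "v + u \<in> V" "v - u \<in> V" using V_W by (auto simp: orthant_def)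
    then have "v + u \<in> P" "v - u \<in> P" by (auto simp: V_def)
    moreover have "v \<in> open_segment (v + u) (v - u)"
    proof -
      have "midpoint (v + u) (v - u) = v"
        by (simp add: midpoint_def algebra_simps flip: scaleR_2)
      moreover have "v + u \<noteq> v - u"
      proof
        assume "v + u = v - u"
        then have "2 *\<^sub>R u = 0" by (simp add: scaleR_2 algebra_simps)
        then show False using u by simp
      qed
      ultimately show ?thesis using midpoint_in_open_segment[of "v + u" "v - u"] by simp
    qed
    ultimately show False using v unfolding extreme_point_of_def by blast
  qed
  then obtain M where M: "linear M" "\<And>x. M (L x) = x" "\<And>x. L (M x) = x"
    using linear_injective_isomorphism[OF linL] by blast
  define \<psi>' where "\<psi>' y = M (\<beta> - y)" for y
  have inv: "\<psi>' (\<psi> x) = x" "\<psi> (\<psi>' y) = y" for x y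
    by (auto simp: \<psi>_def \<psi>'_def M)
  have cont: "continuous_on S \<psi>" "continuous_on S \<psi>'" for S
    using linear_continuous_on[of L S] linear_continuous_on[of M S] linL M(1)
    by (simp_all add: \<psi>_def \<psi>'_def linear_diff linear_conv_bounded_linear continuous_on_diff)
  have inj_\<psi>: "inj_on \<psi> V" by (metis inv(1) inj_on_inverseI)
  have img: "\<psi> ` V = orthant \<inter> \<psi>' -` W"
    using V_W inv by (auto simp: image_iff) (metis inv(2))
  have "(V, \<psi>) \<in> polytope_charts P"
    unfolding polytope_charts_def is_chart_def
  proof (clarsimp, intro conjI)
    have "V = P \<inter> W" using V_W mem_P eF by (auto simp: orthant_def \<psi>_nth V_def)
    then show "openin (top_of_set P) V" using W by auto
    show "openin (top_of_set orthant) (\<psi> ` V)"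
      unfolding img by (intro openin_open_Int open_vimage W cont)
    have "V \<subseteq> P" by (auto simp: V_def)
    then have "subtopology (top_of_set P) V = top_of_set V"
      by (simp add: subtopology_subtopology Int_absorb1)
    moreover have "homeomorphic_maps (top_of_set V) (top_of_set (\<psi> ` V)) \<psi> \<psi>'"
      unfolding homeomorphic_maps_def by (auto simp: inv cont)
    ultimately show "homeomorphic_map (subtopology (top_of_set P) V) (top_of_set (\<psi> ` V)) \<psi>"
      using homeomorphic_maps_map by metis
    show "smooth_on V \<psi>"
    proof (rule smooth_on_affine)
      show "bounded_linear (\<lambda>x. - L x)"
        using linL by (intro bounded_linear_minus) (simp add: linear_conv_bounded_linear)
    qed (auto simp: \<psi>_def)
    show "smooth_on (\<psi> ` V) (inv_into V \<psi>)"
    proof (rule smooth_on_affine)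
      show "bounded_linear (\<lambda>x. - M x)"
        using M(1) by (intro bounded_linear_minus) (simp add: linear_conv_bounded_linear)
      fix y assume "y \<in> \<psi> ` V"
      then have "inv_into V \<psi> y = \<psi>' y" using inj_\<psi> inv by auto
      then show "inv_into V \<psi> y = - M y + M \<beta>" by (simp add: \<psi>'_def linear_diff[OF M(1)])
    qed
  qed
  moreover have "card (zero_set (\<psi> q)) = card {F. F facet_of P \<and> q \<in> F}" if q: "q \<in> V" for q
  proof -
    have qP: "q \<in> P" using q by (auto simp: V_def)
    have "{F. F facet_of P \<and> q \<in> F} = e ` zero_set (\<psi> q)"
    proof (intro set_eqI iffI)
      fix F assume F: "F \<in> {F. F facet_of P \<and> q \<in> F}"
      then obtain i where i: "F = e i" using ex_e q by (auto simp: V_def)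
      then have "i \<in> zero_set (\<psi> q)" using F mem_F[OF _ qP, of F] by (auto simp: zero_set_def \<psi>_nth)
      then show "F \<in> e ` zero_set (\<psi> q)" using i by auto
    qed (use eF mem_F qP in \<open>auto simp: zero_set_def \<psi>_nth\<close>)
    moreover have "inj_on e (zero_set (\<psi> q))"
      using e inj_on_subset unfolding bij_betw_def by blast
    ultimately show ?thesis by (simp add: card_image)
  qed
  ultimately show thesis by (rule that)
qed

text \<open>
  In particular, the domains of the charts above cover \<open>P\<close>. The vertex is taken in the
  intersection of all facets through \<open>q\<close>.
\<close>

lemma polytope_point_near_vertex:
  fixes P :: "(real ^ 'n::finite) set"
  assumes P: "polytope P" and q: "q \<in> P"
  obtains v where "v extreme_point_of P" "\<And>F. F facet_of P \<Longrightarrow> q \<in> F \<Longrightarrow> v \<in> F"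
proof -
  define C where "C = \<Inter>(insert P {F. F facet_of P \<and> q \<in> F})"
  have "C face_of P" unfolding C_def
    by (rule face_of_Inter) (use P polytope_imp_convex face_of_refl facet_of_imp_face_of in blast)+
  then have "polytope C" using P face_of_polytope_polytope by blast
  moreover have "q \<in> C" using q by (auto simp: C_def)
  ultimately obtain v where "v extreme_point_of C"
    using extreme_point_exists_convex polytope_imp_compact polytope_imp_convex by blast
  then have "v extreme_point_of P" "v \<in> C"
    using \<open>C face_of P\<close> extreme_point_of_face by auto
  then show thesis using that by (auto simp: C_def)
qed

text \<open>
  The segment from a point in the relative interior of a facet to a vertex of the facet stays in
  the relative interior until it reaches the vertex.
\<close>

lemma facet_vertex_segment:
  fixes P :: "(real ^ 'n::finite) set"
  assumes P: "simple_polytope P" and F: "F facet_of P"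
    and q: "q \<in> P" "{E. E facet_of P \<and> q \<in> E} = {F}"
  obtains v where "v extreme_point_of P" "card {E. E facet_of P \<and> v \<in> E} = CARD('n)"
    "\<And>s. 0 \<le> s \<Longrightarrow> s < 1 \<Longrightarrow> q + s *\<^sub>R (v - q) \<in> P"
    "\<And>s. 0 \<le> s \<Longrightarrow> s < 1 \<Longrightarrow> {E. E facet_of P \<and> q + s *\<^sub>R (v - q) \<in> E} = {F}"
proof -
  have poly: "polytope P" using P by (simp add: simple_polytope_def)
  have pd: "polytope P" "aff_dim P = int CARD('n)"
    using P by (auto simp: simple_polytope_def)
  obtain a :: "(real ^ 'n) set \<Rightarrow> real ^ 'n" and b :: "(real ^ 'n) set \<Rightarrow> real"
  where fin: "finite {F. F facet_of P}"
    and P_eq: "P = {x. \<forall>F. F facet_of P \<longrightarrow> a F \<bullet> x \<le> b F}"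
    and int: "interior P = {x. \<forall>F. F facet_of P \<longrightarrow> a F \<bullet> x < b F}"
    and F_eq: "\<And>F. F facet_of P \<Longrightarrow> F = P \<inter> {x. a F \<bullet> x = b F}"
    by (rule full_dimensional_polytope_halfspaces[OF pd]) (rule that)
  have mem_P: "x \<in> P \<longleftrightarrow> (\<forall>F. F facet_of P \<longrightarrow> a F \<bullet> x \<le> b F)" for x
    using P_eq by blast
  have mem_F: "x \<in> F \<longleftrightarrow> a F \<bullet> x = b F" if "F facet_of P" "x \<in> P" for F x
    using F_eq[OF that(1)] that(2) by blast
  obtain v where v: "v extreme_point_of P" "\<And>F. F facet_of P \<Longrightarrow> q \<in> F \<Longrightarrow> v \<in> F"
    using polytope_point_near_vertex[OF poly q(1)] by blast
  have vP: "v \<in> P" using v by (simp add: extreme_point_of_def)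
  have qF: "q \<in> F" "v \<in> F" using q v F by auto
  have in_P: "q + s *\<^sub>R (v - q) \<in> P" if "0 \<le> s" "s < 1" for s
  proof -
    have "(1 - s) *\<^sub>R q + s *\<^sub>R v \<in> P"
      using polytope_imp_convex[OF poly] q(1) vP that by (intro convexD) auto
    then show ?thesis by (simp add: algebra_simps)
  qed
  have facets: "{E. E facet_of P \<and> q + s *\<^sub>R (v - q) \<in> E} = {F}" if s: "0 \<le> s" "s < 1" for s
  proof -
    have ev: "a E \<bullet> (q + s *\<^sub>R (v - q)) = (1 - s) * (a E \<bullet> q) + s * (a E \<bullet> v)" for E
      by (simp add: inner_right_distrib inner_diff_right algebra_simps)
    have "q + s *\<^sub>R (v - q) \<in> F"
      using mem_F[OF F in_P[OF s]] ev[of F] mem_F[OF F q(1)] mem_F[OF F vP] qF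
      by (simp add: algebra_simps)
    moreover have "E = F" if E: "E facet_of P" "q + s *\<^sub>R (v - q) \<in> E" for E
    proof (rule ccontr)
      assume "E \<noteq> F"
      then have "q \<notin> E" using q(2) E(1) by auto
      then have "a E \<bullet> q < b E" using mem_F[OF E(1) q(1)] mem_P q(1) E(1) by (auto simp: less_le)
      moreover have "a E \<bullet> v \<le> b E" using mem_P vP E(1) by auto
      ultimately have "(1 - s) * (a E \<bullet> q) + s * (a E \<bullet> v) < (1 - s) * b E + s * b E"
        using s by (intro add_less_le_mono mult_strict_left_mono mult_left_mono) auto
      then show False
        using mem_F[OF E(1) in_P[OF s]] E(2) ev[of E] by (simp add: algebra_simps)
    qed
    ultimately show ?thesis using F by blast
  qed
  have "card {E. E facet_of P \<and> v \<in> E} = CARD('n)"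
    using P v(1) unfolding simple_polytope_def by blast
  then show thesis
    by (rule that[OF v(1) _ in_P facets])
qed

lemma interior_polytope_iff_no_facet:
  fixes P :: "(real ^ 'n::finite) set"
  assumes P: "simple_polytope P" and q: "q \<in> P"
  shows "q \<in> interior P \<longleftrightarrow> card {F. F facet_of P \<and> q \<in> F} = 0"
proof -
  have pd: "polytope P" "aff_dim P = int CARD('n)"
    using P by (auto simp: simple_polytope_def)
  obtain a :: "(real ^ 'n) set \<Rightarrow> real ^ 'n" and b :: "(real ^ 'n) set \<Rightarrow> real"
  where fin: "finite {F. F facet_of P}"
    and P_eq: "P = {x. \<forall>F. F facet_of P \<longrightarrow> a F \<bullet> x \<le> b F}"
    and int: "interior P = {x. \<forall>F. F facet_of P \<longrightarrow> a F \<bullet> x < b F}"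
    and F_eq: "\<And>F. F facet_of P \<Longrightarrow> F = P \<inter> {x. a F \<bullet> x = b F}"
    by (rule full_dimensional_polytope_halfspaces[OF pd]) (rule that)
  have "q \<in> interior P \<longleftrightarrow> (\<forall>F. F facet_of P \<longrightarrow> q \<notin> F)"
    unfolding int using P_eq F_eq q by (auto simp: less_le) blast+
  also have "\<dots> \<longleftrightarrow> {F. F facet_of P \<and> q \<in> F} = {}" by auto
  also have "\<dots> \<longleftrightarrow> card {F. F facet_of P \<and> q \<in> F} = 0"
    using fin by (subst card_0_eq) (auto elim: rev_finite_subset)
  finally show ?thesis .
qed

section \<open>The orbit map of a small cover\<close>

text \<open>The orbit map of the sign action on \<open>\<real>\<^sup>n\<close>, with values in the orthant.\<close>

definition squares :: "real ^ 'n::finite \<Rightarrow> real ^ 'n" where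
  "squares v = (\<chi> i. (v $ i)\<^sup>2)"

lemma zero_set_squares: "zero_set (squares v) = zero_set v"
  by (simp add: zero_set_def squares_def)

lemma squares_eq_iff:
  fixes v w :: "real ^ 'n::finite"
  shows "squares v = squares w \<longleftrightarrow> (\<exists>s. w = sign_action s v)"
proof
  assume eq: "squares v = squares w"
  define s :: "bit ^ 'n" where "s = (\<chi> i. if w $ i = v $ i then 0 else 1)"
  have "w $ i = sign_action s v $ i" for i
  proof -
    have "(v $ i)\<^sup>2 = (w $ i)\<^sup>2" using eq by (simp add: squares_def vec_eq_iff)
    then have "v $ i = w $ i \<or> v $ i = - w $ i" by (simp add: power2_eq_iff)
    then show ?thesis by (auto simp: s_def sign_action_def bit_sign_def)
  qed
  then show "\<exists>s. w = sign_action s v" by (auto simp: vec_eq_iff)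
next
  assume "\<exists>s. w = sign_action s v"
  then show "squares v = squares w"
    by (auto simp: squares_def vec_eq_iff sign_action_def power_mult_distrib bit_sign_def)
qed

text \<open>
  Near \<open>squares a\<close> a continuous right inverse is given by the square roots with the signs of \<open>a\<close>.
\<close>

lemma openin_orthant_squares:
  fixes N :: "(real ^ 'n::finite) set"
  assumes "open N"
  shows "openin (top_of_set orthant) (squares ` N)"
proof (subst openin_subopen, clarify)
  fix a assume a: "a \<in> N"
  define r :: "real ^ 'n \<Rightarrow> real ^ 'n" where
    "r w = (\<chi> i. (if 0 \<le> a $ i then 1 else - 1) * sqrt (w $ i))" for w
  have cont: "continuous_on UNIV r"
    unfolding r_def by (intro continuous_intros)
  have ra: "r (squares a) = a"
    by (auto simp: r_def squares_def vec_eq_iff)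
  have sr: "squares (r w) = w" if "w \<in> orthant" for w
    using that by (auto simp: r_def squares_def vec_eq_iff orthant_def power_mult_distrib)
  let ?T = "orthant \<inter> r -` N"
  have "openin (top_of_set orthant) ?T"
    using assms cont by (intro openin_open_Int) (simp add: open_vimage)
  moreover have "squares a \<in> ?T" using a ra by (auto simp: orthant_def squares_def)
  moreover have "?T \<subseteq> squares ` N" using sr by (metis IntD1 IntD2 image_eqI subsetI vimageD)
  ultimately show "\<exists>T. openin (top_of_set orthant) T \<and> squares a \<in> T \<and> T \<subseteq> squares ` N" by blast
qed

lemma sign_action_fixes_iff: "sign_action t v = v \<longleftrightarrow> (\<forall>i. t $ i \<noteq> 0 \<longrightarrow> v $ i = 0)"
  by (auto simp: sign_action_def vec_eq_iff bit_sign_def)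

lemma bit_vec_supported_at:
  fixes u :: "bit ^ 'n::finite"
  assumes "\<And>i. u $ i \<noteq> 0 \<Longrightarrow> i = k" "u \<noteq> 0"
  shows "u = axis k 1"
proof -
  obtain i where "u $ i \<noteq> 0" using assms(2) by (auto simp: vec_eq_iff)
  then have "u $ k \<noteq> 0" using assms(1) by metis
  then have "u $ k = 1" by (cases "u $ k") auto
  moreover have "u $ i = 0" if "i \<noteq> k" for i using assms(1)[of i] that by blast
  ultimately show ?thesis by (simp add: vec_eq_iff axis_def)
qed

lemma bit_vec_add_self: "(u :: bit ^ 'n::finite) + u = 0"
  by (simp add: vec_eq_iff)

text \<open>
  A small cover together with a fixed diffeomorphism \<open>h\<close> from its orbit space to the polytope.
\<close>

locale small_cover_projection =
  fixes P :: "(real ^ 'n::finite) set" and X :: "'a topology" and A :: "('a, 'n) chart set"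
    and act :: "bit ^ 'n \<Rightarrow> 'a \<Rightarrow> 'a" and h :: "'a set \<Rightarrow> real ^ 'n"
  assumes P: "simple_polytope P"
    and small_cover: "small_cover P X A act"
    and h: "diffeomorphism (orbit_space X act UNIV) (orbit_charts X A act)
      (top_of_set P) (polytope_charts P) h"
begin

text \<open>The orbit map of the whole group, with values in the polytope.\<close>

definition p :: "'a \<Rightarrow> real ^ 'n" where
  "p x = h (action_orbit act UNIV x)"

lemma compact_X: "compact_space X" and Hausdorff_X: "Hausdorff_space X"
  using small_cover by (auto simp: small_cover_def smooth_manifold_def)

lemma act_continuous: "continuous_map X X (act t)"
  and act_0: "x \<in> topspace X \<Longrightarrow> act 0 x = x"
  and act_add: "x \<in> topspace X \<Longrightarrow> act (s + t) x = act s (act t x)"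
  using small_cover by (auto simp: small_cover_def smooth_action_def smooth_map_def)

lemma act_in: "x \<in> topspace X \<Longrightarrow> act t x \<in> topspace X"
  using act_continuous continuous_map_image_subset_topspace by blast

lemma act_act_self: "x \<in> topspace X \<Longrightarrow> act t (act t x) = x"
  using act_add[of x t t] by (simp add: bit_vec_add_self act_0)

lemma orbit_eq_iff:
  assumes "x \<in> topspace X" "y \<in> topspace X"
  shows "action_orbit act UNIV x = action_orbit act UNIV y \<longleftrightarrow> (\<exists>t. y = act t x)"
proof
  assume eq: "action_orbit act UNIV x = action_orbit act UNIV y"
  have "y \<in> action_orbit act UNIV y"
    unfolding action_orbit_def by (rule image_eqI[of _ _ 0]) (simp_all add: act_0 assms(2))
  then show "\<exists>t. y = act t x" unfolding eq[symmetric] by (auto simp: action_orbit_def)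
next
  assume "\<exists>t. y = act t x"
  then obtain t where t: "y = act t x" by blast
  have "act s y = act (s + t) x" "act s x = act (s + t) y" for s
    using act_add[OF assms(1)] act_act_self[OF assms(1)] act_add[OF assms(2)] t by auto
  then show "action_orbit act UNIV x = action_orbit act UNIV y"
    unfolding action_orbit_def by (fastforce simp: image_iff)
qed

lemma homeomorphic_h: "homeomorphic_map (orbit_space X act UNIV) (top_of_set P) h"
  using h by (simp add: diffeomorphism_def)

lemma inj_h: "inj_on h (action_orbit act UNIV ` topspace X)"
  using homeomorphic_h by (simp add: homeomorphic_eq_everything_map topspace_orbit_space)

lemma p_continuous: "continuous_map X (top_of_set P) p"
  using continuous_map_compose[OF quotient_imp_continuous_map[OF quotient_map_orbit_space]
      homeomorphic_imp_continuous_map[OF homeomorphic_h]]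
  by (simp add: p_def[abs_def] o_def)

lemma p_image: "p ` topspace X = P"
  using homeomorphic_imp_surjective_map[OF homeomorphic_h]
  by (simp add: topspace_orbit_space p_def[abs_def] image_image)

lemma p_eq_iff:
  assumes "x \<in> topspace X" "y \<in> topspace X"
  shows "p x = p y \<longleftrightarrow> (\<exists>t. y = act t x)"
  using inj_h assms orbit_eq_iff[OF assms] by (auto simp: p_def inj_on_eq_iff)

lemma open_act_image:
  assumes "openin X U"
  shows "openin X (act t ` U)"
proof -
  have "homeomorphic_maps X X (act t) (act t)"
    by (simp add: homeomorphic_maps_def act_continuous act_act_self)
  then have "homeomorphic_map X X (act t)" using homeomorphic_maps_map by metis
  then show ?thesis
    using assms by (meson homeomorphic_imp_open_map open_map_def)
qed

lemma open_map_orbit: "open_map X (orbit_space X act UNIV) (action_orbit act UNIV)"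
  unfolding open_map_def
proof (intro allI impI)
  fix U assume U: "openin X U"
  then have sub: "U \<subseteq> topspace X" by (rule openin_subset)
  have "{x \<in> topspace X. action_orbit act UNIV x \<in> action_orbit act UNIV ` U} = (\<Union>t. act t ` U)"
  proof (intro set_eqI iffI)
    fix x assume "x \<in> {x \<in> topspace X. action_orbit act UNIV x \<in> action_orbit act UNIV ` U}"
    then obtain u where u: "x \<in> topspace X" "u \<in> U" "action_orbit act UNIV u = action_orbit act UNIV x"
      by auto
    then have "\<exists>t. x = act t u" using orbit_eq_iff[of u x] sub by blast
    then show "x \<in> (\<Union>t. act t ` U)" using u by blast
  next
    fix x assume "x \<in> (\<Union>t. act t ` U)"
    then obtain t u where u: "u \<in> U" "x = act t u" by blast
    then have "x \<in> topspace X" "action_orbit act UNIV u = action_orbit act UNIV x"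
      using orbit_eq_iff[of u x] sub act_in by auto
    then show "x \<in> {x \<in> topspace X. action_orbit act UNIV x \<in> action_orbit act UNIV ` U}"
      using u(1) by blast
  qed
  moreover have "openin X (\<Union>t. act t ` U)" using open_act_image[OF U] by blast
  ultimately show "openin (orbit_space X act UNIV) (action_orbit act UNIV ` U)"
    unfolding openin_orbit_space using sub by auto
qed

lemma open_map_p: "open_map X (top_of_set P) p"
  using open_map_compose[OF open_map_orbit homeomorphic_imp_open_map[OF homeomorphic_h]]
  by (simp add: p_def[abs_def] o_def)

lemma closed_map_p: "closed_map X (top_of_set P) p"
  by (rule continuous_imp_closed_map[OF p_continuous compact_X]) (simp add: Hausdorff_space_subtopology)

text \<open>A standard chart, together with a group automorphism that makes its coordinate map equivariant.\<close>

definition linear_chart :: "'a set \<Rightarrow> ('a \<Rightarrow> real ^ 'n) \<Rightarrow> (bit ^ 'n \<Rightarrow> bit ^ 'n) \<Rightarrow> bool" where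
  "linear_chart U \<phi> \<theta> \<longleftrightarrow> (U, \<phi>) \<in> standard_charts X A act \<and> bij \<theta> \<and>
     (\<forall>s t. \<theta> (s + t) = \<theta> s + \<theta> t) \<and> (\<forall>t. \<forall>x\<in>U. \<phi> (act t x) = sign_action (\<theta> t) (\<phi> x))"

lemma linear_chart_exists:
  assumes "x \<in> topspace X"
  obtains U \<phi> \<theta> where "linear_chart U \<phi> \<theta>" "x \<in> U"
proof -
  obtain c where c: "c \<in> standard_charts X A act" "x \<in> fst c"
    using small_cover assms by (auto simp: small_cover_def locally_standard_def)
  obtain U \<phi> where "c = (U, \<phi>)" by (cases c)
  with c that show thesis by (auto simp: linear_chart_def standard_charts_def)
qed

context
  fixes U \<phi> \<theta>
  assumes chart: "linear_chart U \<phi> \<theta>"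
begin

lemma chart_openin: "openin X U" and chart_open: "open (\<phi> ` U)"
  and chart_homeo: "homeomorphic_map (subtopology X U) (top_of_set (\<phi> ` U)) \<phi>"
  and chart_act_in: "x \<in> U \<Longrightarrow> act t x \<in> U"
  and chart_act: "x \<in> U \<Longrightarrow> \<phi> (act t x) = sign_action (\<theta> t) (\<phi> x)"
  and chart_standard: "(U, \<phi>) \<in> standard_charts X A act"
  and chart_charts_of: "(U, \<phi>) \<in> charts_of X A"
  and chart_bij: "bij \<theta>" and chart_add: "\<theta> (s + t) = \<theta> s + \<theta> t"
  using chart unfolding linear_chart_def standard_charts_def charts_of_def is_chart_def by auto

lemma chart_sub: "U \<subseteq> topspace X"
  by (rule openin_subset[OF chart_openin])

lemma chart_inj: "inj_on \<phi> U"
  using chart_homeo chart_sub by (simp add: homeomorphic_eq_everything_map Int_absorb1)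

lemma chart_zero: "\<theta> 0 = 0"
  using chart_add[of 0 0] by simp

lemma chart_inv: "\<theta> (inv \<theta> s) = s" "inv \<theta> (\<theta> t) = t"
  using chart_bij by (simp_all add: bij_is_surj surj_f_inv_f bij_is_inj)

lemma chart_inv_add: "inv \<theta> (s + t) = inv \<theta> s + inv \<theta> t"
  by (metis chart_inv chart_add)

lemma chart_stabilizer:
  assumes x: "x \<in> U"
  shows "act t x = x \<longleftrightarrow> (\<forall>i. \<theta> t $ i \<noteq> 0 \<longrightarrow> i \<in> zero_set (\<phi> x))"
proof -
  have "act t x = x \<longleftrightarrow> \<phi> (act t x) = \<phi> x"
    using inj_on_eq_iff[OF chart_inj chart_act_in[OF x] x] by blast
  then show ?thesis
    using chart_act[OF x] by (simp add: sign_action_fixes_iff zero_set_def)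
qed

lemma chart_image_openin:
  assumes "openin X W" "W \<subseteq> U"
  shows "open (\<phi> ` W)"
proof -
  have "openin (subtopology X U) W"
    using assms by (simp add: openin_open_subtopology chart_openin)
  then have "openin (top_of_set (\<phi> ` U)) (\<phi> ` W)"
    using homeomorphic_imp_open_map[OF chart_homeo] by (simp add: open_map_def)
  then show ?thesis using chart_open openin_open_eq by blast
qed

lemma orbit_chart_orbit:
  assumes x: "x \<in> U"
  shows "snd (orbit_chart act (U, \<phi>)) (action_orbit act UNIV x) = squares (\<phi> x)"
proof -
  have "x \<in> action_orbit act UNIV x"
    unfolding action_orbit_def by (rule image_eqI[of _ _ 0]) (use act_0 x chart_sub in auto)
  then have "(SOME y. y \<in> action_orbit act UNIV x) \<in> action_orbit act UNIV x"
    by (rule someI)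
  then obtain t where t: "(SOME y. y \<in> action_orbit act UNIV x) = act t x"
    by (auto simp: action_orbit_def)
  have "squares (\<phi> x) = squares (\<phi> (act t x))"
    using squares_eq_iff chart_act[OF x] by blast
  then show ?thesis by (simp add: orbit_chart_def t squares_def)
qed

text \<open>
  The orbit chart \<open>\<phi>'\<close> and the vertex chart \<open>\<psi>\<close> transform the homeomorphism \<open>h\<close> and its inverse into
  smooth maps \<open>f\<close> and \<open>g\<close> between open subsets of the orthant.
\<close>

lemma card_zero_set_eq_facets:
  assumes x: "x \<in> U"
  shows "card (zero_set (\<phi> x)) = card {F. F facet_of P \<and> p x \<in> F}"
proof -
  have "x \<in> topspace X" using x chart_sub by blast
  then have pP: "p x \<in> P" using p_image by blast
  have "polytope P" using P by (simp add: simple_polytope_def)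
  then obtain v where v: "v extreme_point_of P" "\<And>F. F facet_of P \<Longrightarrow> p x \<in> F \<Longrightarrow> v \<in> F"
    using polytope_point_near_vertex[OF _ pP] by blast
  define V where "V = {q \<in> P. \<forall>F. F facet_of P \<longrightarrow> q \<in> F \<longrightarrow> v \<in> F}"
  have pV: "p x \<in> V" using v(2) pP by (auto simp: V_def)
  obtain \<psi> where \<psi>: "(V, \<psi>) \<in> polytope_charts P"
    "\<And>q. q \<in> V \<Longrightarrow> card (zero_set (\<psi> q)) = card {F. F facet_of P \<and> q \<in> F}"
    by (rule simple_polytope_vertex_chart[OF P v(1), folded V_def]) (rule that)
  have \<psi>c: "openin (top_of_set P) V" "openin (top_of_set orthant) (\<psi> ` V)"
    "homeomorphic_map (subtopology (top_of_set P) V) (top_of_set (\<psi> ` V)) \<psi>"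
    using \<psi>(1) by (auto simp: polytope_charts_def is_chart_def)
  have VP: "V \<subseteq> P" by (auto simp: V_def)
  have inj_\<psi>: "inj_on \<psi> V"
    using \<psi>c(3) VP by (simp add: homeomorphic_eq_everything_map Int_absorb1)
  define h' where "h' = inv_into (topspace (orbit_space X act UNIV)) h"
  have h'_p: "h' (p y) = action_orbit act UNIV y" if "y \<in> topspace X" for y
    unfolding h'_def p_def topspace_orbit_space using inj_h that by simp
  define U' where "U' = action_orbit act UNIV ` U"
  define \<phi>' where "\<phi>' = snd (orbit_chart act (U, \<phi>))"
  have oc: "orbit_chart act (U, \<phi>) = (U', \<phi>')"
    by (simp add: U'_def \<phi>'_def orbit_chart_def)
  have \<phi>': "\<phi>' (action_orbit act UNIV y) = squares (\<phi> y)" if "y \<in> U" for y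
    unfolding \<phi>'_def by (rule orbit_chart_orbit[OF that])
  have inj_\<phi>': "inj_on \<phi>' U'"
  proof (rule inj_onI)
    fix b c assume "b \<in> U'" "c \<in> U'" and eq: "\<phi>' b = \<phi>' c"
    then obtain y z where yz: "y \<in> U" "z \<in> U" "b = action_orbit act UNIV y" "c = action_orbit act UNIV z"
      by (auto simp: U'_def)
    then obtain s where "\<phi> z = sign_action s (\<phi> y)" using eq \<phi>' squares_eq_iff by metis
    then have "\<phi> z = \<phi> (act (inv \<theta> s) y)" using chart_act[OF yz(1)] chart_inv by simp
    then have "z = act (inv \<theta> s) y" using inj_onD[OF chart_inj] chart_act_in yz by blast
    then show "b = c" using orbit_eq_iff[of y z] yz chart_sub by blast
  qed
  define D where "D = \<phi>' ` {b \<in> U'. h b \<in> V}"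
  define D' where "D' = \<psi> ` {q \<in> V. h' q \<in> U'}"
  define f where "f = \<psi> \<circ> h \<circ> inv_into U' \<phi>'"
  define g where "g = \<phi>' \<circ> h' \<circ> inv_into V \<psi>"
  have mem: "(U', \<phi>') \<in> orbit_charts X A act"
    using chart_standard oc unfolding orbit_charts_def by (metis image_eqI)
  have smooth: "smooth_on D f" "smooth_on D' g"
  proof -
    have "\<forall>(U, \<phi>)\<in>orbit_charts X A act. \<forall>(V, \<psi>)\<in>polytope_charts P.
        smooth_on (\<phi> ` {b \<in> U. h b \<in> V}) (\<psi> \<circ> h \<circ> inv_into U \<phi>)"
      using h unfolding diffeomorphism_def smooth_map_def by blast
    then have "\<forall>(V, \<psi>)\<in>polytope_charts P. smooth_on (\<phi>' ` {b \<in> U'. h b \<in> V}) (\<psi> \<circ> h \<circ> inv_into U' \<phi>')"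
      using mem by (rule bspec[elim_format]) simp
    then show "smooth_on D f"
      using \<psi>(1) unfolding D_def f_def by (rule bspec[elim_format]) simp
    have "\<forall>(V, \<psi>)\<in>polytope_charts P. \<forall>(U, \<phi>)\<in>orbit_charts X A act.
        smooth_on (\<psi> ` {q \<in> V. h' q \<in> U}) (\<phi> \<circ> h' \<circ> inv_into V \<psi>)"
      using h unfolding diffeomorphism_def smooth_map_def h'_def by blast
    then have "\<forall>(U, \<phi>)\<in>orbit_charts X A act. smooth_on (\<psi> ` {q \<in> V. h' q \<in> U}) (\<phi> \<circ> h' \<circ> inv_into V \<psi>)"
      using \<psi>(1) by (rule bspec[elim_format]) simp
    then show "smooth_on D' g"
      using mem unfolding D'_def g_def by (rule bspec[elim_format]) simp
  qed
  have hp: "h (action_orbit act UNIV y) = p y" for y by (simp add: p_def)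
  have orbit_U': "action_orbit act UNIV y \<in> U'" if "y \<in> U" for y
    using that unfolding U'_def by (rule imageI)
  have D_mem: "w \<in> D \<longleftrightarrow> (\<exists>y\<in>U. p y \<in> V \<and> w = squares (\<phi> y))" for w
  proof
    assume "w \<in> D"
    then obtain b where b: "b \<in> U'" "h b \<in> V" "w = \<phi>' b" unfolding D_def by blast
    then obtain y where y: "y \<in> U" "b = action_orbit act UNIV y" unfolding U'_def by blast
    then show "\<exists>y\<in>U. p y \<in> V \<and> w = squares (\<phi> y)"
      using b(2,3) \<phi>'[OF y(1)] hp[of y] by metis
  next
    assume "\<exists>y\<in>U. p y \<in> V \<and> w = squares (\<phi> y)"
    then obtain y where y: "y \<in> U" "p y \<in> V" "w = squares (\<phi> y)" by blast
    have "action_orbit act UNIV y \<in> {b \<in> U'. h b \<in> V}"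
      using orbit_U'[OF y(1)] y(2) hp[of y] by simp
    moreover have "w = \<phi>' (action_orbit act UNIV y)" using y(3) \<phi>'[OF y(1)] by simp
    ultimately show "w \<in> D" unfolding D_def by blast
  qed
  have fD: "f (squares (\<phi> y)) = \<psi> (p y)" if "y \<in> U" for y
    using inv_into_f_f[OF inj_\<phi>' orbit_U'[OF that]] unfolding f_def comp_def \<phi>'[OF that]
    by (simp only: hp)
  have gD: "g (\<psi> (p y)) = squares (\<phi> y)" if "y \<in> U" "p y \<in> V" for y
    using inv_into_f_f[OF inj_\<psi> that(2)] h'_p[OF subsetD[OF chart_sub that(1)]] \<phi>'[OF that(1)]
    unfolding g_def comp_def by simp
  have D'_mem: "w \<in> D' \<longleftrightarrow> (\<exists>y\<in>U. p y \<in> V \<and> w = \<psi> (p y))" for w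
  proof
    assume "w \<in> D'"
    then obtain q where q: "q \<in> V" "h' q \<in> U'" "w = \<psi> q" by (auto simp: D'_def)
    then obtain y where y: "y \<in> U" "h' q = action_orbit act UNIV y" by (auto simp: U'_def)
    obtain z where z: "z \<in> topspace X" "q = p z" using q(1) VP p_image by blast
    then have "h' q = action_orbit act UNIV z" using h'_p by blast
    then have "p y = q" using y z hp by metis
    then show "\<exists>y\<in>U. p y \<in> V \<and> w = \<psi> (p y)" using y q by blast
  next
    assume "\<exists>y\<in>U. p y \<in> V \<and> w = \<psi> (p y)"
    then obtain y where y: "y \<in> U" "p y \<in> V" "w = \<psi> (p y)" by blast
    then have "h' (p y) \<in> U'" using h'_p[of y] chart_sub by (auto simp: U'_def)
    then show "w \<in> D'" using y by (auto simp: D'_def)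
  qed
  define W where "W = {y \<in> U. p y \<in> V}"
  have "openin X {y \<in> topspace X. p y \<in> V}"
    using p_continuous \<psi>c(1) by (rule openin_continuous_map_preimage)
  then have "openin X (U \<inter> {y \<in> topspace X. p y \<in> V})" using chart_openin by blast
  moreover have "U \<inter> {y \<in> topspace X. p y \<in> V} = W" using chart_sub by (auto simp: W_def)
  ultimately have W: "openin X W" by simp
  have opD: "openin (top_of_set orthant) D"
  proof -
    have "D = squares ` \<phi> ` W" using D_mem by (auto simp: W_def)
    then show ?thesis using openin_orthant_squares chart_image_openin[OF W] by (auto simp: W_def)
  qed
  have opD': "openin (top_of_set orthant) D'"
  proof -
    have "openin (top_of_set P) (p ` W)" using open_map_p W by (simp add: open_map_def)
    then have "openin (subtopology (top_of_set P) V) (p ` W)"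
      using \<psi>c(1) by (subst openin_open_subtopology) (auto simp: W_def)
    then have "openin (top_of_set (\<psi> ` V)) (\<psi> ` p ` W)"
      using homeomorphic_imp_open_map[OF \<psi>c(3)] unfolding open_map_def by blast
    moreover have "D' = \<psi> ` p ` W" using D'_mem by (auto simp: W_def)
    ultimately show ?thesis using \<psi>c(2) openin_trans by blast
  qed
  have "card (zero_set (f (squares (\<phi> x)))) = card (zero_set (squares (\<phi> x)))"
  proof (rule card_zero_set_diffeo[OF opD opD' smooth(1) _ smooth(2)])
    have f_D: "f w \<in> D' \<and> g (f w) = w" if w: "w \<in> D" for w
    proof -
      obtain y where y: "y \<in> U" "p y \<in> V" "w = squares (\<phi> y)" using w D_mem by blast
      then have "f w = \<psi> (p y)" using fD by simp
      then show ?thesis using y D'_mem gD[OF y(1,2)] by metis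
    qed
    have g_D': "g w \<in> D \<and> f (g w) = w" if w: "w \<in> D'" for w
    proof -
      obtain y where y: "y \<in> U" "p y \<in> V" "w = \<psi> (p y)" using w D'_mem by blast
      then have "g w = squares (\<phi> y)" using gD by simp
      then show ?thesis using y D_mem fD[OF y(1)] by metis
    qed
    show "f ` D \<subseteq> D'" "g ` D' \<subseteq> D" using f_D g_D' by blast+
    show "g (f w) = w" if "w \<in> D" for w using f_D[OF that] by blast
    show "f (g w) = w" if "w \<in> D'" for w using g_D'[OF that] by blast
    show "squares (\<phi> x) \<in> D" using D_mem x pV by blast
  qed
  then show ?thesis using \<psi>(2)[OF pV] by (simp add: fD[OF x] zero_set_squares)
qed

end

end

section \<open>Stabilizers over the boundary of the polytope\<close>

lemma index_two_add_mem:
  fixes G :: "'g::group_add set"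
  assumes G: "0 \<in> G" "\<And>s t. s \<in> G \<Longrightarrow> t \<in> G \<Longrightarrow> s + t \<in> G" "\<And>t. t \<in> G \<Longrightarrow> - t \<in> G"
    and index: "card (range (\<lambda>a. (+) a ` G)) = 2"
  shows "s + t \<in> G \<longleftrightarrow> (s \<in> G \<longleftrightarrow> t \<in> G)" and "\<exists>t. t \<notin> G"
proof -
  have coset: "(+) a ` G = (+) b ` G \<Longrightarrow> - a + b \<in> G" for a b
  proof -
    assume eq: "(+) a ` G = (+) b ` G"
    have "b \<in> (+) b ` G" using G(1) by force
    then obtain g where "g \<in> G" "b = a + g" unfolding eq[symmetric] by blast
    then show ?thesis by (simp add: add.assoc[symmetric])
  qed
  obtain C D where CD: "range (\<lambda>a. (+) a ` G) = {C, D}" "C \<noteq> D"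
    using index by (auto simp: card_2_iff)
  have same: "- a + b \<in> G" if "a \<notin> G" "b \<notin> G" for a b
  proof -
    have "(+) a ` G \<noteq> (+) 0 ` G" "(+) b ` G \<noteq> (+) 0 ` G"
      using coset[of 0 a] coset[of 0 b] that by auto
    moreover have "(+) c ` G \<in> {C, D}" for c
      unfolding CD(1)[symmetric] by (rule rangeI)
    ultimately have "(+) a ` G = (+) b ` G" by (metis insertE singletonD)
    then show ?thesis by (rule coset)
  qed
  have neg: "- a \<in> G \<longleftrightarrow> a \<in> G" for a using G(3)[of a] G(3)[of "- a"] by auto
  show "s + t \<in> G \<longleftrightarrow> (s \<in> G \<longleftrightarrow> t \<in> G)"
  proof (cases "s \<in> G")
    case True
    have "t \<in> G" if "s + t \<in> G"
      using G(2)[OF _ that, of "- s"] neg[of s] True by (simp add: add.assoc[symmetric])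
    then show ?thesis using True G(2) by blast
  next
    case s: False
    have "s + t \<notin> G" if "t \<in> G"
    proof
      assume "s + t \<in> G"
      then have "s + t + - t \<in> G" using that G(2,3) by blast
      then show False using s by (simp add: add.assoc)
    qed
    moreover have "s + t \<in> G" if "t \<notin> G" using same[of "- s" t] s that neg[of s] by simp
    ultimately show ?thesis using s by blast
  qed
  show "\<exists>t. t \<notin> G"
  proof (rule ccontr)
    assume "\<nexists>t. t \<notin> G"
    then have "G = UNIV" by blast
    then have "range (\<lambda>a. (+) a ` G) = {UNIV}"
      using surj_plus by auto
    then show False using index by simp
  qed
qed

lemma additive_bit_function_expansion:
  fixes K :: "bit ^ 'n::finite \<Rightarrow> bit"
  assumes add: "\<And>s t. K (s + t) = K s + K t"
  shows "K u = (\<Sum>j\<in>UNIV. K (axis j 1) * u $ j)"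
proof -
  have K0: "K 0 = 0" using add[of 0 0] by simp
  have K_sum: "K (sum f S) = (\<Sum>j\<in>S. K (f j))" if "finite S" for f :: "'n \<Rightarrow> bit ^ 'n" and S
    using that by (induction S rule: finite_induct) (auto simp: K0 add)
  have "u = (\<Sum>j\<in>UNIV. axis j (u $ j))"
    by (simp add: vec_eq_iff axis_def)
  then have "K u = (\<Sum>j\<in>UNIV. K (axis j (u $ j)))"
    using K_sum[of UNIV "\<lambda>j. axis j (u $ j)"] by simp
  also have "\<dots> = (\<Sum>j\<in>UNIV. K (axis j 1) * u $ j)"
  proof (rule sum.cong)
    fix j :: 'n
    have "axis j (0 :: bit) = (0 :: bit ^ 'n)" by (simp add: vec_eq_iff axis_def)
    then have "K (axis j 0) = 0" using K0 by metis
    then show "K (axis j (u $ j)) = K (axis j 1) * u $ j"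
      by (cases "u $ j") simp_all
  qed simp
  finally show ?thesis .
qed

lemma finite_bit_vec: "finite (S :: (bit ^ 'n::finite) set)"
proof (rule finite_subset)
  show "S \<subseteq> (\<lambda>I. \<chi> i. if i \<in> I then 1 else 0) ` (UNIV :: 'n set set)"
  proof
    fix u :: "bit ^ 'n"
    have "u = (\<chi> i. if i \<in> {i. u $ i = 1} then 1 else 0)"
      by (simp add: vec_eq_iff)
    then show "u \<in> (\<lambda>I. \<chi> i. if i \<in> I then 1 else 0) ` UNIV" by blast
  qed
qed simp

lemma linear_sign_action: "linear (sign_action s :: real ^ 'n::finite \<Rightarrow> real ^ 'n)"
  by (rule linearI) (auto simp: sign_action_def vec_eq_iff algebra_simps)

context small_cover_projection
begin

lemma tangent_action_linear_chart:
  assumes chart: "linear_chart U \<phi> \<theta>" and x: "x \<in> U"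
  shows "tangent_action act (U, \<phi>) x t = sign_action (\<theta> t)"
proof -
  have "(sign_action (\<theta> t) has_derivative sign_action (\<theta> t)) (at (\<phi> x))"
    using linear_sign_action linear_conv_bounded_linear bounded_linear_imp_has_derivative by blast
  then have "(\<phi> \<circ> act t \<circ> inv_into U \<phi> has_derivative sign_action (\<theta> t)) (at (\<phi> x))"
  proof (rule has_derivative_transform_within_open)
    show "open (\<phi> ` U)" by (rule chart_open[OF chart])
    show "\<phi> x \<in> \<phi> ` U" using x by blast
    fix v assume "v \<in> \<phi> ` U"
    then obtain z where z: "z \<in> U" "v = \<phi> z" by blast
    then show "sign_action (\<theta> t) v = (\<phi> \<circ> act t \<circ> inv_into U \<phi>) v"
      using inv_into_f_f[OF chart_inj[OF chart]] chart_act[OF chart z(1)] by simp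
  qed
  then show ?thesis
    unfolding tangent_action_def by (simp add: frechet_derivative_at[symmetric])
qed

text \<open>
  At a fixed point the weights are the coordinates of \<open>\<theta>\<close>. Let \<open>K \<circ> \<theta>\<close> be the character of \<open>\<int>\<^sub>2\<^sup>n\<close> with
  kernel \<open>G\<close>, so that \<open>K\<close> is a linear combination of the coordinates that is not trivial. If the
  \<open>i\<close>-th reflection is in \<open>G\<close>, then the \<open>i\<close>-th coefficient vanishes, and on \<open>G\<close> the combination is
  a dependency between the other \<open>n - 1\<close> weights, which contradicts general position.
\<close>

lemma reflection_not_in_subtorus:
  assumes G: "subtorus_in_general_position X A act G"
    and chart: "linear_chart U \<phi> \<theta>" and x: "x \<in> U" and fixed: "\<And>t. act t x = x"
    and t: "\<theta> t = axis i 1"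
  shows "t \<notin> G"
proof
  assume tG: "t \<in> G"
  have sub: "0 \<in> G" "\<And>s t. s \<in> G \<Longrightarrow> t \<in> G \<Longrightarrow> s + t \<in> G" "\<And>t. t \<in> G \<Longrightarrow> - t \<in> G"
    "card (range (\<lambda>a. (+) a ` G)) = 2" and gen: "general_position X A act G"
    using G by (auto simp: subtorus_in_general_position_def)
  note mem = index_two_add_mem[OF sub]
  define K where "K u = (if inv \<theta> u \<in> G then 0 else 1 :: bit)" for u
  have K_add: "K (u + w) = K u + K w" for u w
    by (simp add: K_def chart_inv_add[OF chart] mem(1))
  have expand: "K u = (\<Sum>j\<in>UNIV. K (axis j 1) * u $ j)" for u
    by (rule additive_bit_function_expansion[of K, OF K_add])
  have inv: "inv \<theta> (\<theta> s) = s" "\<theta> (inv \<theta> s) = s" for s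
    using chart_inv[OF chart] by auto
  have Ki: "K (axis i 1) = 0" using tG inv(1)[of t] by (simp add: K_def flip: t)
  define J where "J = UNIV - {i}"
  have J_sum: "(\<Sum>j\<in>UNIV. K (axis j 1) * u $ j) = (\<Sum>j\<in>J. K (axis j 1) * u $ j)" for u
  proof -
    have "(\<Sum>j\<in>UNIV. K (axis j 1) * u $ j) = K (axis i 1) * u $ i + (\<Sum>j\<in>J. K (axis j 1) * u $ j)"
      unfolding J_def by (rule sum.remove) auto
    then show ?thesis unfolding Ki by (simp only: mult_zero_left add_0_left)
  qed
  have "weights_at X A act G x (\<lambda>j s. \<theta> s $ j)"
    unfolding weights_at_def
  proof (intro conjI allI ballI bexI[of _ "(U, \<phi>)"] exI[of _ "\<lambda>j. axis j (1::real)"])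
    show "independent (range (\<lambda>j. axis j (1::real) :: real ^ 'n))"
      by (rule independent_mono[OF independent_Basis]) (auto simp: Basis_vec_def)
    show "tangent_action act (U, \<phi>) x s (axis j 1) = bit_sign (\<theta> s $ j) *\<^sub>R axis j 1" for s j
      unfolding tangent_action_linear_chart[OF chart x]
      by (simp add: sign_action_def vec_eq_iff axis_def)
    show "(U, \<phi>) \<in> charts_of X A" by (rule chart_charts_of[OF chart])
  qed (use x in \<open>auto simp: chart_add[OF chart] inj_def axis_eq_axis\<close>)
  moreover have "x \<in> topspace X" using x chart_sub[OF chart] by blast
  moreover have "card J = CARD('n) - 1" by (simp add: J_def)
  ultimately have ind: "independent_characters G J (\<lambda>j s. \<theta> s $ j)"
    using gen fixed unfolding general_position_def by blast
  have "(\<Sum>j\<in>J. K (axis j 1) * \<theta> s $ j) = 0" if "s \<in> G" for s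
  proof -
    have "K (\<theta> s) = 0" using that inv(1)[of s] by (simp add: K_def)
    then show ?thesis using expand[of "\<theta> s"] J_sum[of "\<theta> s"] by metis
  qed
  then have "\<forall>s\<in>G. (\<Sum>j\<in>J. K (axis j 1) * \<theta> s $ j) = 0" by (rule ballI)
  with spec[OF ind[unfolded independent_characters_def], of "\<lambda>j. K (axis j 1)"]
  have KJ: "\<forall>j\<in>J. K (axis j 1) = 0" by (rule mp)
  have "K u = 0" for u
  proof -
    have "(\<Sum>j\<in>J. K (axis j 1) * u $ j) = 0"
      by (rule sum.neutral) (simp add: KJ)
    then show ?thesis using expand[of u] J_sum[of u] by metis
  qed
  moreover obtain s where "s \<notin> G" using mem(2) by blast
  then have "K (\<theta> s) = 1" using inv(1)[of s] by (simp add: K_def)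
  ultimately show False by (metis zero_neq_one)
qed

lemma closed_p_fixed: "closed (p ` {x \<in> topspace X. act t x = x})"
proof -
  have "closedin X {x \<in> topspace X. act t x = x}"
    using closedin_continuous_maps_eq[OF Hausdorff_X act_continuous[of t] continuous_map_id] by simp
  then have "closedin (top_of_set P) (p ` {x \<in> topspace X. act t x = x})"
    using closed_map_p by (simp add: closed_map_def)
  moreover have "closed P"
    using P polytope_imp_closed by (auto simp: simple_polytope_def)
  ultimately show ?thesis using closedin_closed_trans by blast
qed

text \<open>All points of a fibre of \<open>p\<close> have the same stabilizer, because the group is commutative.\<close>

lemma act_fixed_fibre:
  assumes "x \<in> topspace X" "y \<in> topspace X" "p x = p y" "act t x = x"
  shows "act t y = y"
proof -
  obtain s where s: "y = act s x" using assms p_eq_iff by blast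
  have "act t y = act (t + s) x" using act_add[OF assms(1)] s by simp
  also have "\<dots> = act s (act t x)" using act_add[OF assms(1), of s t] by (simp add: add.commute)
  finally show ?thesis using s assms(4) by simp
qed

text \<open>
  Over a point that lies on exactly one facet, the stabilizer consists of \<open>0\<close> and one reflection.
\<close>

lemma single_facet_chart:
  assumes F: "{F. F facet_of P \<and> p x \<in> F} = {F0}" and chart: "linear_chart U \<phi> \<theta>" and x: "x \<in> U"
  obtains k where "zero_set (\<phi> x) = {k}" "\<And>t. act t x = x \<longleftrightarrow> t = 0 \<or> \<theta> t = axis k 1"
proof -
  have "card (zero_set (\<phi> x)) = 1"
    using card_zero_set_eq_facets[OF chart x] F by simp
  then obtain k where k: "zero_set (\<phi> x) = {k}" by (auto simp: card_1_singleton_iff)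
  have "act t x = x \<longleftrightarrow> t = 0 \<or> \<theta> t = axis k 1" for t
  proof -
    have "\<theta> t = 0 \<longleftrightarrow> t = 0" using chart_zero[OF chart] chart_bij[OF chart] by (metis bij_pointE)
    moreover have "(\<forall>i. \<theta> t $ i \<noteq> 0 \<longrightarrow> i = k) \<longleftrightarrow> \<theta> t = 0 \<or> \<theta> t = axis k 1"
    proof
      assume "\<forall>i. \<theta> t $ i \<noteq> 0 \<longrightarrow> i = k"
      then show "\<theta> t = 0 \<or> \<theta> t = axis k 1" using bit_vec_supported_at[of "\<theta> t" k] by blast
    next
      assume "\<theta> t = 0 \<or> \<theta> t = axis k 1"
      then show "\<forall>i. \<theta> t $ i \<noteq> 0 \<longrightarrow> i = k" by (auto simp: axis_def split: if_splits)
    qed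
    ultimately show ?thesis using chart_stabilizer[OF chart x, of t] k by simp
  qed
  then show thesis using that k by blast
qed

text \<open>
  Let \<open>I\<close> be the segment from \<open>p x\<close> to a vertex \<open>v\<close> of the facet, without \<open>v\<close>. For each \<open>s \<noteq> 0\<close>, the
  points whose fibre is fixed by \<open>s\<close> form a closed set \<open>B s\<close>. These finitely many sets partition
  the connected set \<open>I\<close>, so \<open>I\<close> lies in \<open>B t\<close>. In a chart at the fixed point over \<open>v\<close>, the
  element \<open>t\<close> is then one of the coordinate reflections.
\<close>

lemma facet_reflection_not_in_subtorus:
  assumes G: "subtorus_in_general_position X A act G"
    and x: "x \<in> topspace X" and F: "{F. F facet_of P \<and> p x \<in> F} = {F0}"
    and t: "act t x = x" "t \<noteq> 0"
  shows "t \<notin> G"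
proof -
  have qP: "p x \<in> P" using p_image x by blast
  have F0: "F0 facet_of P" using F by blast
  obtain v where v: "v extreme_point_of P" "card {E. E facet_of P \<and> v \<in> E} = CARD('n)"
    and seg_P: "\<And>s. 0 \<le> s \<Longrightarrow> s < 1 \<Longrightarrow> p x + s *\<^sub>R (v - p x) \<in> P"
    and seg_F: "\<And>s. 0 \<le> s \<Longrightarrow> s < 1 \<Longrightarrow> {E. E facet_of P \<and> p x + s *\<^sub>R (v - p x) \<in> E} = {F0}"
    by (rule facet_vertex_segment[OF P F0 qP F]) (rule that)
  define c where "c s = p x + s *\<^sub>R (v - p x)" for s :: real
  define B where "B s = p ` {x \<in> topspace X. act s x = x}" for s
  define I where "I = c ` {0..<1}"
  have cont_c: "continuous_on S c" for S unfolding c_def by (intro continuous_intros)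
  have "connected I" unfolding I_def
    by (rule connected_continuous_image[OF cont_c]) (simp add: connected_iff_interval)
  have I_facets: "{F. F facet_of P \<and> w \<in> F} = {F0}" if w: "w \<in> I" for w
  proof -
    obtain s where "w = p x + s *\<^sub>R (v - p x)" "0 \<le> s" "s < 1"
      using w unfolding I_def c_def by fastforce
    then show ?thesis using seg_F[of s] by simp
  qed
  have unique: "s = s'" if w: "w \<in> I" "w \<in> B s" "w \<in> B s'" and nz: "s \<noteq> 0" "s' \<noteq> 0" for w s s'
  proof -
    obtain y where y: "y \<in> topspace X" "w = p y" "act s y = y" using w(2) by (auto simp: B_def)
    obtain y' where y': "y' \<in> topspace X" "w = p y'" "act s' y' = y'" using w(3) by (auto simp: B_def)
    have s': "act s' y = y" using act_fixed_fibre[OF y'(1) y(1)] y y' by simp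
    obtain U \<phi> \<theta> where chart: "linear_chart U \<phi> \<theta>" "y \<in> U" using linear_chart_exists[OF y(1)] by blast
    have F1: "{F. F facet_of P \<and> p y \<in> F} = {F0}"
      using I_facets[OF w(1)] y(2) by simp
    obtain k where "zero_set (\<phi> y) = {k}" and k: "\<And>t. act t y = y \<longleftrightarrow> t = 0 \<or> \<theta> t = axis k 1"
      by (rule single_facet_chart[OF F1 chart]) (rule that)
    have "\<theta> s = \<theta> s'" using k[of s] k[of s'] y(3) s' nz by simp
    then show ?thesis using chart_bij[OF chart(1)] by (metis chart_inv(2)[OF chart(1)])
  qed
  have cover: "\<exists>s. s \<noteq> 0 \<and> w \<in> B s" if w: "w \<in> I" for w
  proof -
    have "w \<in> P" using w seg_P by (auto simp: I_def c_def)
    then obtain y where y: "y \<in> topspace X" "w = p y" using p_image by blast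
    obtain U \<phi> \<theta> where chart: "linear_chart U \<phi> \<theta>" "y \<in> U" using linear_chart_exists[OF y(1)] by blast
    have F1: "{F. F facet_of P \<and> p y \<in> F} = {F0}"
      using I_facets[OF w] y(2) by simp
    obtain k where "zero_set (\<phi> y) = {k}" and k: "\<And>t. act t y = y \<longleftrightarrow> t = 0 \<or> \<theta> t = axis k 1"
      by (rule single_facet_chart[OF F1 chart]) (rule that)
    let ?s = "inv \<theta> (axis k 1)"
    have s: "\<theta> ?s = axis k 1" by (rule chart_inv(1)[OF chart(1)])
    have "?s \<noteq> 0"
    proof
      assume "?s = 0"
      then have "axis k (1::bit) = 0" using s chart_zero[OF chart(1)] by simp
      then show False by (simp add: axis_eq_0_iff)
    qed
    moreover have "w \<in> B ?s" using k[of ?s] s y by (auto simp: B_def)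
    ultimately show ?thesis by blast
  qed
  have I_B: "I \<subseteq> B t"
  proof -
    let ?R = "\<Union>s\<in>UNIV - {0, t}. B s"
    have cl: "closed (B t)" "closed ?R"
      using closed_p_fixed finite_bit_vec by (auto simp: B_def intro!: closed_UN)
    have I_sub: "I \<subseteq> B t \<union> ?R"
    proof
      fix w assume "w \<in> I"
      then obtain s where "s \<noteq> 0" "w \<in> B s" using cover by blast
      then show "w \<in> B t \<union> ?R" by (cases "s = t") auto
    qed
    have disj: "B t \<inter> ?R \<inter> I = {}"
    proof (rule equals0I)
      fix w assume "w \<in> B t \<inter> ?R \<inter> I"
      then obtain s where "w \<in> I" "w \<in> B t" "w \<in> B s" "s \<noteq> 0" "s \<noteq> t" by auto
      then show False using unique[of w t s] t(2) by auto
    qed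
    have "c 0 = p x" by (simp add: c_def)
    then have "p x \<in> I" unfolding I_def by (metis atLeastLessThan_iff imageI order_refl zero_less_one)
    moreover have "p x \<in> B t" using x t(1) by (auto simp: B_def)
    ultimately have R_I: "?R \<inter> I = {}"
      using connected_closedD[OF \<open>connected I\<close> disj I_sub cl] by auto
    show ?thesis
    proof
      fix w assume w: "w \<in> I"
      have "w \<notin> ?R" using R_I w by (metis IntI empty_iff)
      then show "w \<in> B t" using subsetD[OF I_sub w] by (simp only: Un_iff simp_thms)
    qed
  qed
  have "v \<in> P" using v(1) by (simp add: extreme_point_of_def)
  then obtain y where y: "y \<in> topspace X" "p y = v" using p_image by blast
  obtain U \<phi> \<theta> where chart: "linear_chart U \<phi> \<theta>" "y \<in> U" using linear_chart_exists[OF y(1)] by blast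
  have "card (zero_set (\<phi> y)) = CARD('n)"
    using card_zero_set_eq_facets[OF chart] v(2) y(2) by simp
  then have "zero_set (\<phi> y) = UNIV" using card_subset_eq[of UNIV "zero_set (\<phi> y)"] by simp
  then have fixed: "act s y = y" for s using chart_stabilizer[OF chart, of s] by simp
  have "openin (top_of_set P) (p ` U)"
    using open_map_p chart_openin[OF chart(1)] by (simp add: open_map_def)
  then obtain W where W: "open W" "p ` U = P \<inter> W" by (auto simp: openin_open)
  have "(c \<longlongrightarrow> c 1) (at_left 1)"
    unfolding c_def by (intro tendsto_intros)
  moreover have "c 1 \<in> W" using y chart(2) W(2) by (auto simp: c_def)
  ultimately have "\<forall>\<^sub>F s in at_left 1. c s \<in> W"
    using topological_tendstoD[OF _ W(1)] by blast
  moreover have "\<forall>\<^sub>F s in at_left (1::real). s \<in> {0<..<1}" by (rule eventually_at_left_real) simp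
  ultimately have "\<forall>\<^sub>F s in at_left (1::real). c s \<in> W \<and> s \<in> {0<..<1}" by (rule eventually_conj)
  then obtain s where s: "c s \<in> W" "0 < s" "s < 1"
    using eventually_happens'[OF trivial_limit_at_left_real] by fastforce
  then have "c s \<in> p ` U" using W(2) seg_P[of s] by (auto simp: c_def)
  then obtain z where z: "z \<in> U" "p z = c s" by auto
  have zX: "z \<in> topspace X" using z(1) chart_sub[OF chart(1)] by blast
  have "c s \<in> B t" using I_B s by (auto simp: I_def)
  then obtain z' where z': "z' \<in> topspace X" "p z' = c s" "act t z' = z'" by (auto simp: B_def)
  then have tz: "act t z = z" using act_fixed_fibre[OF z'(1) zX] z(2) by simp
  have F1: "{F. F facet_of P \<and> p z \<in> F} = {F0}" using seg_F[of s] s z(2) by (simp add: c_def)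
  obtain k where "zero_set (\<phi> z) = {k}" and k: "\<And>t. act t z = z \<longleftrightarrow> t = 0 \<or> \<theta> t = axis k 1"
    by (rule single_facet_chart[OF F1 chart(1) z(1)]) (rule that)
  have "\<theta> t = axis k 1" using k[of t] tz t(2) by blast
  then show ?thesis using reflection_not_in_subtorus[OF G chart fixed] by blast
qed

text \<open>
  If the \<open>i\<close>-th coordinate of \<open>x\<close> vanishes, a small perturbation of the other vanishing
  coordinates leads to a point on exactly one facet that is still fixed by the \<open>i\<close>-th reflection.
\<close>

lemma stabilizer_not_in_subtorus:
  assumes G: "subtorus_in_general_position X A act G"
    and x: "x \<in> topspace X" and bd: "p x \<notin> interior P"
  shows "\<exists>t. t \<notin> G \<and> act t x = x"
proof -
  obtain U \<phi> \<theta> where chart: "linear_chart U \<phi> \<theta>" "x \<in> U" using linear_chart_exists[OF x] by blast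
  have "p x \<in> P" using p_image x by blast
  then have "card (zero_set (\<phi> x)) \<noteq> 0"
    using interior_polytope_iff_no_facet[OF P] bd card_zero_set_eq_facets[OF chart] by simp
  then obtain i where i: "\<phi> x $ i = 0" by (auto simp: zero_set_def)
  define t where "t = inv \<theta> (axis i 1)"
  have t: "\<theta> t = axis i 1" unfolding t_def by (rule chart_inv(1)[OF chart(1)])
  have t0: "t \<noteq> 0"
  proof
    assume "t = 0"
    then have "axis i (1::bit) = 0" using t chart_zero[OF chart(1)] by simp
    then show False by (simp add: axis_eq_0_iff)
  qed
  have fix_iff: "act t y = y \<longleftrightarrow> \<phi> y $ i = 0" if "y \<in> U" for y
    using chart_stabilizer[OF chart(1) that, of t] by (auto simp: t axis_def zero_set_def)
  define w :: "real ^ 'n" where "w = (\<chi> j. if \<phi> x $ j = 0 \<and> j \<noteq> i then 1 else 0)"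
  have "((\<lambda>\<epsilon>. \<phi> x + \<epsilon> *\<^sub>R w) \<longlongrightarrow> \<phi> x + 0 *\<^sub>R w) (at_right (0::real))"
    by (intro tendsto_intros)
  then have "\<forall>\<^sub>F \<epsilon> in at_right 0. \<phi> x + \<epsilon> *\<^sub>R w \<in> \<phi> ` U"
    by (rule topological_tendstoD) (use chart chart_open[OF chart(1)] in auto)
  moreover have "\<forall>\<^sub>F \<epsilon> in at_right (0::real). 0 < \<epsilon>" by (simp add: eventually_at_filter)
  ultimately have "\<forall>\<^sub>F \<epsilon> in at_right 0. \<phi> x + \<epsilon> *\<^sub>R w \<in> \<phi> ` U \<and> 0 < \<epsilon>" by (rule eventually_conj)
  then obtain \<epsilon> where \<epsilon>: "\<phi> x + \<epsilon> *\<^sub>R w \<in> \<phi> ` U" "0 < \<epsilon>"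
    using eventually_happens'[OF trivial_limit_at_right_real] by blast
  then obtain z where z: "z \<in> U" "\<phi> z = \<phi> x + \<epsilon> *\<^sub>R w" by auto
  have "zero_set (\<phi> z) = {i}"
    using \<epsilon>(2) i by (auto simp: zero_set_def z(2) w_def split: if_splits)
  then have "card {F. F facet_of P \<and> p z \<in> F} = 1"
    using card_zero_set_eq_facets[OF chart(1) z(1)] by simp
  then obtain F0 where F0: "{F. F facet_of P \<and> p z \<in> F} = {F0}" by (auto simp: card_1_singleton_iff)
  have "\<phi> z $ i = 0" using i by (simp add: z(2) w_def)
  then have "act t z = z" using fix_iff[OF z(1)] by blast
  moreover have "z \<in> topspace X" using z(1) chart_sub[OF chart(1)] by blast
  ultimately have "t \<notin> G" using facet_reflection_not_in_subtorus[OF G _ F0] t0 by blast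
  moreover have "act t x = x" using fix_iff[OF chart(2)] i by blast
  ultimately show ?thesis by blast
qed

end

section \<open>Local signs over the interior of the polytope\<close>

text \<open>The vector of signs, written additively, of a vector without vanishing coordinates.\<close>

definition sign_vector :: "real ^ 'n::finite \<Rightarrow> bit ^ 'n" where
  "sign_vector v = (\<chi> i. if v $ i < 0 then 1 else 0)"

lemma sign_vector_sign_action:
  assumes "zero_set v = {}"
  shows "sign_vector (sign_action t v) = t + sign_vector v"
proof (subst vec_eq_iff, rule allI)
  fix i
  have "v $ i \<noteq> 0" using assms by (auto simp: zero_set_def)
  then show "sign_vector (sign_action t v) $ i = (t + sign_vector v) $ i"
    by (cases "t $ i") (auto simp: sign_vector_def sign_action_def bit_sign_def)
qed

lemma continuous_on_sign_vector:
  fixes f :: "bit ^ 'n::finite \<Rightarrow> real"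
  shows "continuous_on {v. zero_set v = {}} (\<lambda>v. f (sign_vector v))"
proof (rule continuous_at_imp_continuous_on, rule ballI)
  fix v :: "real ^ 'n" assume v: "v \<in> {v. zero_set v = {}}"
  have "\<forall>\<^sub>F w in at v. (w $ i < 0) = (v $ i < 0)" for i
  proof -
    have lim: "((\<lambda>w. w $ i) \<longlongrightarrow> v $ i) (at v)" by (intro tendsto_intros)
    have "v $ i \<noteq> 0" using v by (auto simp: zero_set_def)
    then consider "v $ i < 0" | "0 < v $ i" by linarith
    then show ?thesis
    proof cases
      case 1
      then show ?thesis using order_tendstoD(2)[OF lim 1] by (auto elim: eventually_mono)
    next
      case 2
      then show ?thesis using order_tendstoD(1)[OF lim 2] by (auto elim: eventually_mono)
    qed
  qed
  then have "\<forall>\<^sub>F w in at v. \<forall>i. (w $ i < 0) = (v $ i < 0)"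
    by (simp add: eventually_all_finite)
  then have "\<forall>\<^sub>F w in at v. f (sign_vector w) = f (sign_vector v)"
    by eventually_elim (simp add: sign_vector_def)
  then show "isCont (\<lambda>v. f (sign_vector v)) v"
    unfolding isCont_def by (rule tendsto_eventually)
qed

text \<open>
  A free orbit in a standard chart contains exactly one point with positive coordinates. The sign
  of the group element that leads from there to a given point is the required function.
\<close>

lemma (in small_cover_projection) local_sign:
  fixes sg :: "bit ^ 'n \<Rightarrow> real"
  assumes sg_sign: "\<And>t. sg t = 1 \<or> sg t = - 1" and sg_add: "\<And>s t. sg (s + t) = sg s * sg t"
    and x: "x \<in> topspace X"
  obtains U \<sigma> where "openin X U" "x \<in> U"
    "continuous_map (subtopology X {z \<in> U. p z \<in> interior P}) euclideanreal \<sigma>"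
    "\<And>z. \<sigma> z = 1 \<or> \<sigma> z = - 1" "\<And>z t. z \<in> U \<Longrightarrow> p z \<in> interior P \<Longrightarrow> \<sigma> (act t z) = sg t * \<sigma> z"
    "\<And>z t. z \<in> U \<Longrightarrow> act t z \<in> U"
proof -
  obtain U \<phi> \<theta> where chart: "linear_chart U \<phi> \<theta>" "x \<in> U" using linear_chart_exists[OF x] by blast
  have U: "openin X U" "U \<subseteq> topspace X" by (rule chart_openin[OF chart(1)], rule chart_sub[OF chart(1)])
  have free: "zero_set (\<phi> z) = {}" if z: "z \<in> U" "p z \<in> interior P" for z
  proof -
    have "p z \<in> P" using p_image z(1) U(2) by blast
    then have "card (zero_set (\<phi> z)) = 0"
      using interior_polytope_iff_no_facet[OF P] z card_zero_set_eq_facets[OF chart(1)] by simp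
    then show ?thesis by simp
  qed
  define \<sigma> where "\<sigma> z = sg (inv \<theta> (sign_vector (\<phi> z)))" for z
  let ?V = "{z \<in> U. p z \<in> interior P}"
  have "continuous_map (subtopology X U) euclidean \<phi>"
    using homeomorphic_imp_continuous_map[OF chart_homeo[OF chart(1)]] continuous_map_in_subtopology by blast
  then have "continuous_map (subtopology X ?V) euclidean \<phi>"
    by (rule continuous_map_from_subtopology_mono) auto
  then have "continuous_map (subtopology X ?V) (top_of_set {v. zero_set v = {}}) \<phi>"
    using free by (auto simp: continuous_map_in_subtopology)
  then have "continuous_map (subtopology X ?V) euclideanreal ((\<lambda>v. sg (inv \<theta> (sign_vector v))) \<circ> \<phi>)"
    by (rule continuous_map_compose) (use continuous_on_sign_vector[of "\<lambda>s. sg (inv \<theta> s)"] in simp)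
  then have "continuous_map (subtopology X ?V) euclideanreal \<sigma>"
    by (simp add: \<sigma>_def[abs_def] o_def)
  moreover have "\<sigma> (act t z) = sg t * \<sigma> z" if z: "z \<in> U" "p z \<in> interior P" for z t
    using chart_act[OF chart(1) z(1), of t] sign_vector_sign_action[OF free[OF z]]
    by (simp add: \<sigma>_def chart_inv_add[OF chart(1)] chart_inv[OF chart(1)] sg_add)
  moreover have "\<sigma> z = 1 \<or> \<sigma> z = - 1" for z unfolding \<sigma>_def by (rule sg_sign)
  ultimately show thesis
    using that[of U \<sigma>] U(1) chart(2) chart_act_in[OF chart(1)] by blast
qed

section \<open>Actions with orbit space a ball\<close>

lemma quotient_maps_same_fibres_homeomorphic:
  assumes f: "quotient_map X Y f" and g: "quotient_map X Z g"
    and fg: "\<And>x y. x \<in> topspace X \<Longrightarrow> y \<in> topspace X \<Longrightarrow> f x = f y \<longleftrightarrow> g x = g y"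
  shows "Y homeomorphic_space Z"
proof -
  obtain h where h: "continuous_map Y Z h" "\<And>x. x \<in> topspace X \<Longrightarrow> h (f x) = g x"
    using quotient_map_lift_exists[OF f quotient_imp_continuous_map[OF g]] fg by metis
  obtain k where k: "continuous_map Z Y k" "\<And>x. x \<in> topspace X \<Longrightarrow> k (g x) = f x"
    using quotient_map_lift_exists[OF g quotient_imp_continuous_map[OF f]] fg by metis
  have "homeomorphic_maps Y Z h k"
    unfolding homeomorphic_maps_def
    using h k quotient_imp_surjective_map[OF f] quotient_imp_surjective_map[OF g] by force
  then show ?thesis
    unfolding homeomorphic_space_def by blast
qed

text \<open>
  The orbit map \<open>\<pi>\<close> of a group action on a compact space, with the closed unit ball as orbit space,
  and a sign character \<open>sg\<close> of the group that is not trivial on the stabilizers over the boundary.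
  The orbit space of the kernel of \<open>sg\<close> is folded onto the ball by \<open>\<pi>\<close>.
\<close>

locale folded_ball =
  fixes X :: "'a topology" and act :: "'g::group_add \<Rightarrow> 'a \<Rightarrow> 'a"
    and sg :: "'g \<Rightarrow> real" and \<pi> :: "'a \<Rightarrow> 'b::euclidean_space"
  assumes act_in: "\<And>t x. x \<in> topspace X \<Longrightarrow> act t x \<in> topspace X"
    and act_0: "\<And>x. x \<in> topspace X \<Longrightarrow> act 0 x = x"
    and act_add: "\<And>s t x. x \<in> topspace X \<Longrightarrow> act (s + t) x = act s (act t x)"
    and sg_sign: "\<And>t. sg t = 1 \<or> sg t = - 1"
    and sg_add: "\<And>s t. sg (s + t) = sg s * sg t"
    and sg_nontrivial: "\<exists>t. sg t = - 1"
    and compact_X: "compact_space X"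
    and \<pi>_cont: "continuous_map X euclidean \<pi>"
    and \<pi>_image: "\<pi> ` topspace X = cball 0 1"
    and \<pi>_open: "open_map X (top_of_set (cball 0 1)) \<pi>"
    and \<pi>_fibre: "\<And>x y. x \<in> topspace X \<Longrightarrow> y \<in> topspace X \<Longrightarrow> \<pi> x = \<pi> y \<longleftrightarrow> (\<exists>t. y = act t x)"
    and boundary: "\<And>x. x \<in> topspace X \<Longrightarrow> norm (\<pi> x) = 1 \<Longrightarrow> \<exists>t. sg t = - 1 \<and> act t x = x"
begin

text \<open>The part of \<open>X\<close> over a subset of the ball.\<close>

definition over :: "'b set \<Rightarrow> 'a set" where
  "over K = {x \<in> topspace X. \<pi> x \<in> K}"

text \<open>
  A continuous choice of a sign on the part of \<open>X\<close> over \<open>K\<close> that transforms by the character \<open>sg\<close>.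
  It amounts to a section over \<open>K\<close> of the two-sheeted map from the orbit space of the kernel of \<open>sg\<close>
  to the ball.
\<close>

definition sign_section :: "'b set \<Rightarrow> ('a \<Rightarrow> real) \<Rightarrow> bool" where
  "sign_section K \<sigma> \<longleftrightarrow> continuous_map (subtopology X (over K)) euclideanreal \<sigma> \<and>
     (\<forall>x\<in>over K. (\<sigma> x = 1 \<or> \<sigma> x = - 1) \<and> (\<forall>t. \<sigma> (act t x) = sg t * \<sigma> x))"

lemma \<pi>_act: "x \<in> topspace X \<Longrightarrow> \<pi> (act t x) = \<pi> x"
  using \<pi>_fibre act_in by metis

lemma over_mono: "K \<subseteq> L \<Longrightarrow> over K \<subseteq> over L"
  by (auto simp: over_def)

lemma topspace_over: "topspace (subtopology X (over K)) = over K"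
  by (auto simp: over_def)

lemma sign_section_mono: "sign_section L \<sigma> \<Longrightarrow> K \<subseteq> L \<Longrightarrow> sign_section K \<sigma>"
  using over_mono[of K L] continuous_map_from_subtopology_mono
  unfolding sign_section_def by blast

lemma sign_section_uminus: "sign_section K \<sigma> \<Longrightarrow> sign_section K (\<lambda>x. - \<sigma> x)"
  unfolding sign_section_def by (auto intro: continuous_map_minus)

lemma sign_section_empty: "sign_section {} \<sigma>"
  by (auto simp: sign_section_def over_def continuous_map_on_empty)

lemma continuous_map_\<pi>:
  fixes f :: "'b \<Rightarrow> real"
  assumes "continuous_on UNIV f"
  shows "continuous_map X euclideanreal (\<lambda>x. f (\<pi> x))"
  using continuous_map_compose[OF \<pi>_cont, of euclideanreal f] assms by (simp add: o_def)

lemma openin_over: "open U \<Longrightarrow> openin X (over U)"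
  using \<pi>_cont by (auto simp: over_def continuous_map_def)

lemma \<pi>_over: "K \<subseteq> cball 0 1 \<Longrightarrow> \<pi> ` over K = K"
  using \<pi>_image by (auto simp: over_def)

lemma openin_\<pi>_image:
  assumes K: "K \<subseteq> cball 0 1" and U: "openin (subtopology X (over K)) U"
  shows "openin (top_of_set K) (\<pi> ` U)"
proof -
  have "open_map (subtopology X (over K)) (subtopology (top_of_set (cball 0 1)) K) \<pi>"
    by (rule open_map_restriction[OF \<pi>_open]) (simp add: over_def)
  then show ?thesis
    using U K by (simp add: open_map_def subtopology_subtopology Int_absorb1)
qed

text \<open>
  The product of two sign sections is constant on the fibres of \<open>\<pi>\<close>. As \<open>\<pi>\<close> is open, it descends to
  a locally constant function on \<open>K\<close>.
\<close>

lemma sign_section_unique: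
  assumes K: "connected K" "K \<subseteq> cball 0 1" and \<sigma>: "sign_section K \<sigma>" and \<tau>: "sign_section K \<tau>"
  shows "(\<forall>x\<in>over K. \<sigma> x = \<tau> x) \<or> (\<forall>x\<in>over K. \<sigma> x = - \<tau> x)"
proof -
  let ?X = "subtopology X (over K)"
  have cont: "continuous_map ?X euclideanreal (\<lambda>x. \<sigma> x * \<tau> x)"
    using \<sigma> \<tau> unfolding sign_section_def by (intro continuous_map_real_mult) auto
  define A where "A = {x \<in> over K. \<sigma> x * \<tau> x > 0}"
  define B where "B = {x \<in> over K. \<sigma> x * \<tau> x < 0}"
  have "openin ?X A" "openin ?X B"
    using cont unfolding continuous_map_upper_lower_semicontinuous_lt A_def B_def topspace_over by auto
  then have op: "openin (top_of_set K) (\<pi> ` A)" "openin (top_of_set K) (\<pi> ` B)"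
    using openin_\<pi>_image[OF K(2)] by auto
  have sgn: "(\<sigma> x = 1 \<or> \<sigma> x = - 1) \<and> (\<tau> x = 1 \<or> \<tau> x = - 1)" if "x \<in> over K" for x
    using \<sigma> \<tau> that unfolding sign_section_def by blast
  have cover: "over K = A \<union> B" using sgn by (fastforce simp: A_def B_def)
  have "\<pi> ` A \<inter> \<pi> ` B = {}"
  proof (rule ccontr)
    assume "\<pi> ` A \<inter> \<pi> ` B \<noteq> {}"
    then obtain x y where xy: "x \<in> A" "y \<in> B" "\<pi> x = \<pi> y" by auto
    then obtain t where t: "y = act t x" using \<pi>_fibre by (auto simp: A_def B_def over_def)
    have "\<sigma> y * \<tau> y = (sg t * \<sigma> x) * (sg t * \<tau> x)"
      using \<sigma> \<tau> xy(1) unfolding t sign_section_def A_def by auto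
    also have "\<dots> = \<sigma> x * \<tau> x" using sg_sign[of t] by auto
    finally show False using xy by (auto simp: A_def B_def)
  qed
  moreover have "K \<subseteq> \<pi> ` A \<union> \<pi> ` B"
    using \<pi>_over[OF K(2)] cover by (metis image_Un order_refl)
  ultimately have "\<pi> ` A = {} \<or> \<pi> ` B = {}"
    using K(1) op unfolding connected_openin by blast
  then have "over K = A \<or> over K = B" using cover by auto
  moreover have "\<sigma> x = \<tau> x" if "x \<in> A" for x
    using sgn[of x] that by (auto simp: A_def)
  moreover have "\<sigma> x = - \<tau> x" if "x \<in> B" for x
    using sgn[of x] that by (auto simp: B_def)
  ultimately show ?thesis by blast
qed

text \<open>
  A hyperplane cuts a convex set in a convex and hence connected set. Over this set, sections on
  the two sides agree up to a global sign, which is absorbed in one of them.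
\<close>

lemma sign_section_glue:
  assumes K: "convex K" "K \<subseteq> cball 0 1"
    and \<sigma>: "sign_section (K \<inter> {y. y \<bullet> i \<le> c}) \<sigma>" and \<tau>: "sign_section (K \<inter> {y. y \<bullet> i \<ge> c}) \<tau>"
  shows "\<exists>\<rho>. sign_section K \<rho>"
proof -
  let ?M = "K \<inter> {y. y \<bullet> i = c}"
  have "{y. y \<bullet> i = c} = {y. i \<bullet> y = c}" by (simp add: inner_commute)
  then have "convex ?M" using K(1) convex_hyperplane[of i c] by (simp add: convex_Int)
  then have "(\<forall>x\<in>over ?M. \<sigma> x = \<tau> x) \<or> (\<forall>x\<in>over ?M. \<sigma> x = - \<tau> x)"
    using sign_section_mono[OF \<sigma>, of ?M] sign_section_mono[OF \<tau>, of ?M] K(2)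
    by (intro sign_section_unique convex_connected) auto
  then obtain \<tau>' where \<tau>': "sign_section (K \<inter> {y. y \<bullet> i \<ge> c}) \<tau>'" "\<forall>x\<in>over ?M. \<sigma> x = \<tau>' x"
    using \<tau> sign_section_uminus[OF \<tau>] by blast
  define \<rho> where "\<rho> x = (if \<pi> x \<bullet> i \<le> c then \<sigma> x else \<tau>' x)" for x
  have c1: "continuous_map (subtopology X (over K)) euclideanreal (\<lambda>x. \<pi> x \<bullet> i)"
    by (rule continuous_map_from_subtopology[OF continuous_map_\<pi>]) (intro continuous_intros)
  have sub1: "over K \<inter> {x \<in> over K. \<pi> x \<bullet> i \<le> c} = over (K \<inter> {y. y \<bullet> i \<le> c})"
    and sub2: "over K \<inter> {x \<in> over K. c \<le> \<pi> x \<bullet> i} = over (K \<inter> {y. y \<bullet> i \<ge> c})"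
    by (auto simp: over_def)
  have "continuous_map (subtopology X (over K)) euclideanreal \<rho>"
    unfolding \<rho>_def
  proof (rule continuous_map_cases_le[OF c1])
    show "\<sigma> x = \<tau>' x" if "x \<in> topspace (subtopology X (over K))" "\<pi> x \<bullet> i = c" for x
      using that \<tau>'(2) by (auto simp: over_def)
  qed (use \<sigma> \<tau>'(1) in \<open>auto simp: sign_section_def topspace_over subtopology_subtopology sub1 sub2
        simp del: topspace_subtopology\<close>)
  moreover have "(\<rho> x = 1 \<or> \<rho> x = - 1) \<and> (\<forall>t. \<rho> (act t x) = sg t * \<rho> x)" if x: "x \<in> over K" for x
  proof (cases "\<pi> x \<bullet> i \<le> c")
    case True
    then have "x \<in> over (K \<inter> {y. y \<bullet> i \<le> c})" using x by (auto simp: over_def)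
    then show ?thesis using True x \<pi>_act \<sigma> by (auto simp: \<rho>_def sign_section_def over_def)
  next
    case False
    then have "x \<in> over (K \<inter> {y. y \<bullet> i \<ge> c})" using x by (auto simp: over_def)
    then show ?thesis using False x \<pi>_act \<tau>'(1) by (auto simp: \<rho>_def sign_section_def over_def)
  qed
  ultimately have "sign_section K \<rho>" unfolding sign_section_def by blast
  then show ?thesis by blast
qed

text \<open>
  By induction on the set \<open>S\<close> of coordinates, there are sections over thin slabs of \<open>K\<close> around every
  point, where the coordinates in \<open>S\<close> are not restricted. The step adds one coordinate to \<open>S\<close>: along
  it, finitely many slabs are glued by a bisection argument. For \<open>S\<close> empty, the slab is
  contained in a small ball. For \<open>S\<close> the set of all coordinates, it is \<open>K\<close>.
\<close>

lemma sign_section_closed_convex: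
  assumes K: "convex K" "closed K" "K \<subseteq> ball 0 1"
    and local: "\<And>y. y \<in> K \<Longrightarrow> \<exists>e>0. \<exists>\<sigma>. sign_section (K \<inter> ball y e) \<sigma>"
  shows "\<exists>\<sigma>. sign_section K \<sigma>"
proof -
  have Kc: "K \<subseteq> cball 0 1" using K(3) ball_subset_cball by blast
  have loc: "\<exists>e>0. \<exists>\<sigma>. sign_section (K \<inter> ball y e) \<sigma>" for y
  proof (cases "y \<in> K")
    case False
    then obtain e where "e > 0" "ball y e \<subseteq> - K"
      using K(2) open_contains_ball[of "- K"] by auto
    moreover from this have "K \<inter> ball y e = {}" by auto
    ultimately show ?thesis using sign_section_empty by metis
  qed (rule local)
  have "\<forall>y. \<exists>\<delta>>0. \<exists>\<sigma>. sign_section {x \<in> K. \<forall>i\<in>Basis - S. \<bar>x \<bullet> i - y \<bullet> i\<bar> < \<delta>} \<sigma>"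
    if "finite S" "S \<subseteq> (Basis :: 'b set)" for S
    using that
  proof (induction S rule: finite_induct)
    case empty
    show ?case
    proof
      fix y
      obtain e \<sigma> where e: "e > 0" "sign_section (K \<inter> ball y e) \<sigma>" using loc by blast
      let ?\<delta> = "e / real DIM('b)"
      have "{x \<in> K. \<forall>i\<in>Basis - {}. \<bar>x \<bullet> i - y \<bullet> i\<bar> < ?\<delta>} \<subseteq> K \<inter> ball y e"
      proof clarsimp
        fix x assume x: "\<forall>i\<in>Basis. \<bar>x \<bullet> i - y \<bullet> i\<bar> < ?\<delta>"
        have "norm (x - y) \<le> (\<Sum>i\<in>Basis. \<bar>(x - y) \<bullet> i\<bar>)" by (rule norm_le_l1)
        also have "\<dots> < of_nat DIM('b) * ?\<delta>"
          by (rule sum_bounded_above_strict) (use x in \<open>auto simp: inner_diff_left\<close>)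
        finally show "dist y x < e" by (simp add: dist_norm norm_minus_commute)
      qed
      then show "\<exists>\<delta>>0. \<exists>\<sigma>. sign_section {x \<in> K. \<forall>i\<in>Basis - {}. \<bar>x \<bullet> i - y \<bullet> i\<bar> < \<delta>} \<sigma>"
        using e sign_section_mono by (intro exI[of _ ?\<delta>]) (auto intro!: exI[of _ \<sigma>])
    qed
  next
    case (insert j S)
    then have j: "j \<in> Basis" by simp
    show ?case
    proof
      fix y
      define R where "R \<delta> a b = {x \<in> K. (\<forall>i\<in>Basis - insert j S. \<bar>x \<bullet> i - y \<bullet> i\<bar> < \<delta>) \<and>
          a \<le> x \<bullet> j \<and> x \<bullet> j \<le> b}" for \<delta> a b
      have R_conv: "convex (R \<delta> a b)" for \<delta> a b
      proof -
        have "R \<delta> a b = K \<inter> (\<Inter>i\<in>Basis - insert j S. {x. i \<bullet> x < y \<bullet> i + \<delta>} \<inter> {x. i \<bullet> x > y \<bullet> i - \<delta>})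
            \<inter> {x. j \<bullet> x \<ge> a} \<inter> {x. j \<bullet> x \<le> b}"
          by (auto simp: R_def inner_commute abs_diff_less_iff)
        then show ?thesis
          by (simp add: K(1) convex_Int convex_INT convex_halfspace_lt convex_halfspace_gt
              convex_halfspace_le convex_halfspace_ge)
      qed
      have "(- 1 :: real) \<le> 1" by simp
      then have "\<exists>\<delta>>0. \<exists>\<sigma>. sign_section (R \<delta> (- 1) 1) \<sigma>"
      proof (induct rule: Bolzano[where P = "\<lambda>a b. \<exists>\<delta>>0. \<exists>\<sigma>. sign_section (R \<delta> a b) \<sigma>"])
        case (trans a b c)
        then obtain \<delta>1 \<sigma>1 \<delta>2 \<sigma>2 where s: "\<delta>1 > 0" "sign_section (R \<delta>1 a b) \<sigma>1"
          "\<delta>2 > 0" "sign_section (R \<delta>2 b c) \<sigma>2" by blast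
        let ?\<delta> = "min \<delta>1 \<delta>2"
        have "\<exists>\<rho>. sign_section (R ?\<delta> a c) \<rho>"
        proof (rule sign_section_glue[OF R_conv])
          show "R ?\<delta> a c \<subseteq> cball 0 1" using Kc by (auto simp: R_def)
          show "sign_section (R ?\<delta> a c \<inter> {y. y \<bullet> j \<le> b}) \<sigma>1"
            by (rule sign_section_mono[OF s(2)]) (auto simp: R_def)
          show "sign_section (R ?\<delta> a c \<inter> {y. y \<bullet> j \<ge> b}) \<sigma>2"
            by (rule sign_section_mono[OF s(4)]) (auto simp: R_def)
        qed
        then show ?case using s by (intro exI[of _ ?\<delta>]) auto
      next
        case (local x)
        \<comment> \<open>The point \<open>y\<close> with its \<open>j\<close>-th coordinate replaced by \<open>x\<close>.\<close>
        let ?y = "y + (x - y \<bullet> j) *\<^sub>R j"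
        have yj: "?y \<bullet> j = x" using j by (simp add: inner_add_left)
        have yi: "?y \<bullet> i = y \<bullet> i" if "i \<in> Basis" "i \<noteq> j" for i
          using that j by (simp add: inner_add_left inner_not_same_Basis)
        have "\<exists>\<delta>>0. \<exists>\<sigma>. sign_section {z \<in> K. \<forall>i\<in>Basis - S. \<bar>z \<bullet> i - ?y \<bullet> i\<bar> < \<delta>} \<sigma>"
          using insert by blast
        then obtain \<delta> \<sigma> where s: "\<delta> > 0"
          "sign_section {z \<in> K. \<forall>i\<in>Basis - S. \<bar>z \<bullet> i - ?y \<bullet> i\<bar> < \<delta>} \<sigma>" by blast
        have "sign_section (R \<delta> a b) \<sigma>" if "a \<le> x" "x \<le> b" "b - a < \<delta>" for a b
        proof (rule sign_section_mono[OF s(2)], rule subsetI, simp, intro conjI ballI)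
          fix z assume z: "z \<in> R \<delta> a b"
          then show "z \<in> K" by (simp add: R_def)
          fix i assume i: "i \<in> Basis - S"
          show "\<bar>z \<bullet> i - ?y \<bullet> i\<bar> < \<delta>"
          proof (cases "i = j")
            case True
            then show ?thesis using yj z that by (auto simp: R_def)
          next
            case False
            then show ?thesis using yi[of i] z i by (auto simp: R_def)
          qed
        qed
        then show ?case using s(1) by blast
      qed
      then obtain \<delta> \<sigma> where s: "\<delta> > 0" "sign_section (R \<delta> (- 1) 1) \<sigma>" by blast
      have "{x \<in> K. \<forall>i\<in>Basis - insert j S. \<bar>x \<bullet> i - y \<bullet> i\<bar> < \<delta>} = R \<delta> (- 1) 1"
      proof -
        have "- 1 \<le> x \<bullet> j \<and> x \<bullet> j \<le> 1" if "x \<in> K" for x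
          using Basis_le_norm[OF j, of x] Kc that by (auto simp: abs_le_iff)
        then show ?thesis by (auto simp: R_def)
      qed
      then show "\<exists>\<delta>>0. \<exists>\<sigma>. sign_section {x \<in> K. \<forall>i\<in>Basis - insert j S. \<bar>x \<bullet> i - y \<bullet> i\<bar> < \<delta>} \<sigma>"
        using s by (intro exI[of _ \<delta>] conjI exI[of _ \<sigma>]) simp_all
    qed
  qed
  from this[of Basis] show ?thesis by auto
qed

text \<open>
  The open ball is exhausted by closed balls. Over these, the sections are normalized at a point
  over the centre, so that they extend each other.
\<close>

lemma sign_section_ball:
  assumes local: "\<And>y. y \<in> ball 0 1 \<Longrightarrow> \<exists>e>0. \<exists>\<sigma>. sign_section (ball 0 1 \<inter> ball y e) \<sigma>"
  shows "\<exists>\<sigma>. sign_section (ball 0 1) \<sigma>"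
proof -
  obtain x0 where x0: "x0 \<in> topspace X" "\<pi> x0 = 0"
    using \<pi>_image by (metis centre_in_cball image_iff zero_le_one)
  define r where "r m = 1 - 1 / (real m + 2)" for m :: nat
  have r: "0 < r m" "r m < 1" for m by (auto simp: r_def field_simps)
  have r_mono: "r m \<le> r k" if "m \<le> k" for m k
    using that by (auto simp: r_def field_simps)
  have "\<exists>\<sigma>. sign_section (cball 0 (r m)) \<sigma> \<and> \<sigma> x0 = 1" for m
  proof -
    have sub: "cball 0 (r m) \<subseteq> ball (0::'b) 1" using r[of m] by auto
    have "\<exists>e>0. \<exists>\<sigma>. sign_section (cball 0 (r m) \<inter> ball y e) \<sigma>" if y: "y \<in> cball 0 (r m)" for y
    proof -
      obtain e \<sigma> where "e > 0" "sign_section (ball 0 1 \<inter> ball y e) \<sigma>"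
        using local[of y] y sub by blast
      then show ?thesis
        using sign_section_mono[of "ball 0 1 \<inter> ball y e" \<sigma> "cball 0 (r m) \<inter> ball y e"] sub by blast
    qed
    then obtain \<sigma> where \<sigma>: "sign_section (cball 0 (r m)) \<sigma>"
      using sign_section_closed_convex[of "cball 0 (r m)"] sub by auto
    have "x0 \<in> over (cball 0 (r m))" using x0 r[of m] by (auto simp: over_def)
    then have "\<sigma> x0 = 1 \<or> - \<sigma> x0 = 1" using \<sigma> by (force simp: sign_section_def)
    then show ?thesis using \<sigma> sign_section_uminus[OF \<sigma>] by blast
  qed
  then obtain \<sigma> where \<sigma>: "\<And>m. sign_section (cball 0 (r m)) (\<sigma> m)" "\<And>m. \<sigma> m x0 = 1"
    by metis
  have agree: "\<sigma> m x = \<sigma> k x" if "m \<le> k" "x \<in> over (cball 0 (r m))" for m k x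
  proof -
    have x0m: "x0 \<in> over (cball 0 (r m))" using x0 r[of m] by (auto simp: over_def)
    have "sign_section (cball 0 (r m)) (\<sigma> k)"
      by (rule sign_section_mono[OF \<sigma>(1)]) (use r_mono[OF that(1)] in auto)
    then have "(\<forall>x\<in>over (cball 0 (r m)). \<sigma> m x = \<sigma> k x) \<or>
        (\<forall>x\<in>over (cball 0 (r m)). \<sigma> m x = - \<sigma> k x)"
      using r[of m] by (intro sign_section_unique \<sigma>(1)) auto
    then show ?thesis using that(2) x0m \<sigma>(2) by fastforce
  qed
  define N where "N x = (LEAST m. norm (\<pi> x) < r m)" for x
  have N: "norm (\<pi> x) < r (N x)" if "x \<in> over (ball 0 1)" for x
  proof -
    have "0 < 1 - norm (\<pi> x)" using that by (auto simp: over_def)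
    then obtain m where "inverse (real (Suc m)) < 1 - norm (\<pi> x)" using reals_Archimedean by blast
    moreover have "1 / (real m + 2) \<le> inverse (real (Suc m))" by (simp add: field_simps)
    ultimately have "norm (\<pi> x) < r m" by (simp add: r_def)
    then show ?thesis unfolding N_def by (rule LeastI)
  qed
  have N_eq: "\<sigma> (N x) x = \<sigma> m x" if "x \<in> over (ball 0 1)" "norm (\<pi> x) < r m" for x m
  proof (rule agree)
    show "N x \<le> m" unfolding N_def using that(2) by (rule Least_le)
    show "x \<in> over (cball 0 (r (N x)))" using N[OF that(1)] that(1) by (auto simp: over_def)
  qed
  have "continuous_map (subtopology X (over (ball 0 1))) euclideanreal (\<lambda>x. \<sigma> (N x) x)"
  proof (rule pasting_lemma[where I = UNIV and T = "\<lambda>m. over (ball 0 (r m))" and f = \<sigma>])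
    fix m :: nat
    have sub: "over (ball 0 (r m)) \<subseteq> over (ball 0 1)"
      using r[of m] by (intro over_mono) auto
    have op: "openin X (over (ball 0 (r m)))"
      by (rule openin_over) simp
    show "openin (subtopology X (over (ball 0 1))) (over (ball 0 (r m)))"
      using op sub openin_over[of "ball 0 1"] by (simp add: openin_open_subtopology)
    have "sign_section (ball 0 (r m)) (\<sigma> m)"
      using \<sigma>(1)[of m] ball_subset_cball by (rule sign_section_mono)
    then show "continuous_map (subtopology (subtopology X (over (ball 0 1))) (over (ball 0 (r m))))
        euclideanreal (\<sigma> m)"
      using sub by (simp add: sign_section_def subtopology_subtopology Int_absorb1)
  next
    fix m k x
    assume "x \<in> topspace (subtopology X (over (ball 0 1))) \<inter> over (ball 0 (r m)) \<inter> over (ball 0 (r k))"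
    then have x: "x \<in> over (ball 0 1)" "norm (\<pi> x) < r m" "norm (\<pi> x) < r k"
      by (auto simp: over_def)
    show "\<sigma> m x = \<sigma> k x" using N_eq[OF x(1,2)] N_eq[OF x(1,3)] by simp
  next
    fix x assume "x \<in> topspace (subtopology X (over (ball 0 1)))"
    then have "x \<in> over (ball 0 1)" by (simp add: topspace_over del: topspace_subtopology)
    then show "\<exists>j. j \<in> UNIV \<and> x \<in> over (ball 0 (r j)) \<and> \<sigma> (N x) x = \<sigma> j x"
      using N[of x] by (intro exI[of _ "N x"]) (auto simp: over_def)
  qed
  moreover have "(\<sigma> (N x) x = 1 \<or> \<sigma> (N x) x = - 1) \<and>
      (\<forall>t. \<sigma> (N (act t x)) (act t x) = sg t * \<sigma> (N x) x)" if x: "x \<in> over (ball 0 1)" for x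
  proof -
    have "x \<in> over (cball 0 (r (N x)))" using N[OF x] x by (auto simp: over_def)
    moreover have "N (act t x) = N x" for t
      using x by (simp add: N_def \<pi>_act over_def)
    ultimately show ?thesis using \<sigma>(1)[of "N x"] by (auto simp: sign_section_def)
  qed
  ultimately have "sign_section (ball 0 1) (\<lambda>x. \<sigma> (N x) x)"
    unfolding sign_section_def by blast
  then show ?thesis by blast
qed


lemma orbit_eq_iff:
  assumes "x \<in> topspace X" "y \<in> topspace X"
  shows "action_orbit act {t. sg t = 1} x = action_orbit act {t. sg t = 1} y \<longleftrightarrow>
    (\<exists>t. sg t = 1 \<and> y = act t x)"
proof -
  have sg0: "sg 0 = 1" using sg_add[of 0 0] sg_sign[of 0] by auto
  have sgm: "sg (- t) = sg t" for t using sg_add[of t "- t"] sg0 sg_sign[of t] by auto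
  show ?thesis
  proof
    assume eq: "action_orbit act {t. sg t = 1} x = action_orbit act {t. sg t = 1} y"
    have "y \<in> action_orbit act {t. sg t = 1} y"
      using act_0[OF assms(2)] sg0 by (force simp: action_orbit_def)
    then show "\<exists>t. sg t = 1 \<and> y = act t x" unfolding eq[symmetric] by (auto simp: action_orbit_def)
  next
    assume "\<exists>t. sg t = 1 \<and> y = act t x"
    then obtain t where t: "sg t = 1" "y = act t x" by blast
    have "act s y = act (s + t) x" "act s x = act (s - t) y" for s
      using act_add[OF assms(1), of s t] act_add[OF assms(1), of "s - t" t] t(2) by auto
    moreover have "sg (s + t) = 1" "sg (s - t) = 1" if "sg s = 1" for s
      using that t(1) sg_add[of s t] sg_add[of s "- t"] sgm[of t] by auto
    ultimately show "action_orbit act {t. sg t = 1} x = action_orbit act {t. sg t = 1} y"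
      unfolding action_orbit_def by (fastforce simp: image_iff)
  qed
qed

text \<open>
  The last coordinate \<open>f\<close> of the map to the sphere is continuous at the boundary of the ball, where
  the sign is not defined, since \<open>\<bar>f\<bar> = g\<close> tends to \<open>0\<close> there.
\<close>

theorem orbit_space_homeomorphic_nsphere:
  assumes local: "\<And>y. y \<in> ball 0 1 \<Longrightarrow> \<exists>e>0. \<exists>\<sigma>. sign_section (ball 0 1 \<inter> ball y e) \<sigma>"
  shows "orbit_space X act {t. sg t = 1} homeomorphic_space nsphere DIM('b)"
proof -
  obtain \<sigma> where \<sigma>: "sign_section (ball 0 1) \<sigma>" using sign_section_ball[OF local] by blast
  have \<sigma>1: "(\<sigma> x)\<^sup>2 = 1" and \<sigma>_act: "\<sigma> (act t x) = sg t * \<sigma> x"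
    if "x \<in> topspace X" "norm (\<pi> x) < 1" for x t
    using \<sigma> that by (force simp: sign_section_def over_def)+
  have norm_\<pi>: "norm (\<pi> x) \<le> 1" if "x \<in> topspace X" for x
    using \<pi>_image that by auto
  define g where "g x = sqrt (1 - (norm (\<pi> x))\<^sup>2)" for x
  define f where "f x = (if norm (\<pi> x) < 1 then \<sigma> x * g x else 0)" for x
  have g_pos: "g x > 0" if "norm (\<pi> x) < 1" for x
    using that by (simp add: g_def power_less_one_iff abs_square_less_1)
  have f_sq: "(f x)\<^sup>2 = 1 - (norm (\<pi> x))\<^sup>2" if "x \<in> topspace X" for x
  proof (cases "norm (\<pi> x) < 1")
    case True
    then have "(norm (\<pi> x))\<^sup>2 \<le> 1" by (simp add: power_le_one)
    then show ?thesis using True \<sigma>1[OF that True] by (simp add: f_def g_def power_mult_distrib)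
  next
    case False
    then show ?thesis using norm_\<pi>[OF that] by (simp add: f_def)
  qed
  have g_abs: "g x = \<bar>f x\<bar>" if "x \<in> topspace X" for x
    using f_sq[OF that] by (simp add: g_def flip: real_sqrt_abs)
  have cont_g: "continuous_map X euclideanreal g"
    unfolding g_def by (rule continuous_map_\<pi>) (intro continuous_intros)
  have cont_f: "continuous_map X euclideanreal f"
  proof -
    let ?U = "over (ball 0 1)"
    have opU: "openin X ?U" by (rule openin_over) simp
    have "continuous_map (subtopology X ?U) euclideanreal (\<lambda>x. \<sigma> x * g x)"
      using \<sigma> cont_g unfolding sign_section_def
      by (intro continuous_map_real_mult) (auto intro: continuous_map_from_subtopology)
    then have "continuous_map (subtopology X ?U) euclideanreal f"
      by (rule continuous_map_eq) (auto simp: f_def over_def)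
    then have opf: "openin X {x \<in> ?U. f x > a}" "openin X {x \<in> ?U. f x < a}" for a
      using opU unfolding continuous_map_upper_lower_semicontinuous_lt topspace_over
      by (auto intro: openin_trans_full)
    have opg: "openin X {x \<in> topspace X. g x < a}" for a
      using cont_g unfolding continuous_map_upper_lower_semicontinuous_lt by blast
    have out: "f x = 0" if "x \<in> topspace X" "x \<notin> ?U" for x
      using that by (auto simp: f_def over_def)
    have topU: "?U \<subseteq> topspace X" by (auto simp: over_def)
    show ?thesis
      unfolding continuous_map_upper_lower_semicontinuous_lt
    proof (intro conjI allI)
      fix a
      show "openin X {x \<in> topspace X. f x > a}"
      proof (cases "a \<ge> 0")
        case True
        then have "{x \<in> topspace X. f x > a} = {x \<in> ?U. f x > a}" using out topU by force
        then show ?thesis using opf by simp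
      next
        case False
        then have "{x \<in> topspace X. f x > a} = {x \<in> ?U. f x > a} \<union> {x \<in> topspace X. g x < - a}"
          using out topU g_abs by (force simp: abs_less_iff)
        then show ?thesis using opf opg by (simp add: openin_Un)
      qed
      show "openin X {x \<in> topspace X. f x < a}"
      proof (cases "a \<le> 0")
        case True
        then have "{x \<in> topspace X. f x < a} = {x \<in> ?U. f x < a}" using out topU by force
        then show ?thesis using opf by simp
      next
        case False
        then have "{x \<in> topspace X. f x < a} = {x \<in> ?U. f x < a} \<union> {x \<in> topspace X. g x < a}"
          using out topU g_abs by (force simp: abs_less_iff)
        then show ?thesis using opf opg by (simp add: openin_Un)
      qed
    qed
  qed
  let ?n = "DIM('b)"
  obtain e :: "nat \<Rightarrow> 'b" where e: "bij_betw e {..<?n} Basis"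
    using ex_bij_betw_nat_finite[OF finite_Basis] by (auto simp: atLeast0LessThan)
  have norm_sum: "(norm y)\<^sup>2 = (\<Sum>k<?n. (y \<bullet> e k)\<^sup>2)" for y
  proof -
    have "(norm y)\<^sup>2 = y \<bullet> y" by (rule power2_norm_eq_inner)
    also have "\<dots> = (\<Sum>b\<in>Basis. (y \<bullet> b)\<^sup>2)"
      by (simp add: euclidean_inner[of y y] power2_eq_square)
    also have "\<dots> = (\<Sum>k<?n. (y \<bullet> e k)\<^sup>2)"
      using sum.reindex_bij_betw[OF e, of "\<lambda>b. (y \<bullet> b)\<^sup>2"] by simp
    finally show ?thesis .
  qed
  have eq_e: "y = z" if "\<And>k. k < ?n \<Longrightarrow> y \<bullet> e k = z \<bullet> e k" for y z
  proof (rule euclidean_eqI)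
    fix b :: 'b assume "b \<in> Basis"
    then obtain k where "k < ?n" "b = e k" using e by (auto simp: bij_betw_def)
    then show "y \<bullet> b = z \<bullet> b" using that by simp
  qed
  define \<Psi> where "\<Psi> x = (\<lambda>k. if k < ?n then \<pi> x \<bullet> e k else if k = ?n then f x else 0)" for x
  have \<Psi>_eq: "\<Psi> x = \<Psi> y \<longleftrightarrow> \<pi> x = \<pi> y \<and> f x = f y" for x y
  proof
    assume eq: "\<Psi> x = \<Psi> y"
    have "\<pi> x \<bullet> e k = \<pi> y \<bullet> e k" if "k < ?n" for k
      using fun_cong[OF eq, of k] that by (simp add: \<Psi>_def)
    moreover have "f x = f y" using fun_cong[OF eq, of ?n] by (simp add: \<Psi>_def)
    ultimately show "\<pi> x = \<pi> y \<and> f x = f y" using eq_e by blast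
  qed (auto simp: \<Psi>_def fun_eq_iff)
  have sum_split: "(\<Sum>k\<le>?n. (z k)\<^sup>2) = (\<Sum>k<?n. (z k)\<^sup>2) + (z ?n)\<^sup>2" for z :: "nat \<Rightarrow> real"
    by (simp flip: lessThan_Suc_atMost)
  have top_sphere: "z \<in> topspace (nsphere ?n) \<longleftrightarrow>
      (\<Sum>k<?n. (z k)\<^sup>2) + (z ?n)\<^sup>2 = 1 \<and> (\<forall>k>?n. z k = 0)" for z
    by (auto simp: nsphere sum_split)
  have \<Psi>_in: "\<Psi> x \<in> topspace (nsphere ?n)" if "x \<in> topspace X" for x
    unfolding top_sphere using f_sq[OF that] norm_sum[of "\<pi> x"] by (simp add: \<Psi>_def)
  have cont: "continuous_map X (nsphere ?n) \<Psi>"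
  proof -
    have "continuous_map X euclideanreal (\<lambda>x. \<Psi> x k)" for k
    proof -
      consider "k < ?n" | "k = ?n" | "k > ?n" by linarith
      then show ?thesis
      proof cases
        case 1
        then show ?thesis
          using continuous_map_\<pi>[of "\<lambda>y. y \<bullet> e k"] by (simp add: \<Psi>_def continuous_intros)
      next
        case 2
        then show ?thesis using cont_f by (simp add: \<Psi>_def)
      next
        case 3
        then show ?thesis by (simp add: \<Psi>_def)
      qed
    qed
    then have "continuous_map X (powertop_real UNIV) \<Psi>"
      by (simp add: continuous_map_componentwise_UNIV)
    moreover have "\<Psi> ` topspace X \<subseteq> {x. (\<Sum>i\<le>?n. (x i)\<^sup>2) = 1 \<and> (\<forall>i>?n. x i = 0)}"
      using \<Psi>_in by (auto simp: nsphere)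
    ultimately show ?thesis
      unfolding nsphere by (simp add: continuous_map_in_subtopology image_subset_iff_funcset)
  qed
  have surj: "\<Psi> ` topspace X = topspace (nsphere ?n)"
  proof
    show "\<Psi> ` topspace X \<subseteq> topspace (nsphere ?n)" using \<Psi>_in by blast
    show "topspace (nsphere ?n) \<subseteq> \<Psi> ` topspace X"
    proof
      fix z assume "z \<in> topspace (nsphere ?n)"
      then have z: "(\<Sum>k<?n. (z k)\<^sup>2) + (z ?n)\<^sup>2 = 1" "\<And>k. k > ?n \<Longrightarrow> z k = 0"
        unfolding top_sphere by auto
      define y where "y = (\<Sum>b\<in>Basis. z (inv_into {..<?n} e b) *\<^sub>R b)"
      have ye: "y \<bullet> e k = z k" if "k < ?n" for k
      proof -
        have "e k \<in> Basis" using e that by (auto simp: bij_betw_def)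
        then have "y \<bullet> e k = z (inv_into {..<?n} e (e k))"
          by (simp add: y_def inner_sum_left_Basis)
        then show ?thesis using e that by (simp add: bij_betw_def)
      qed
      have yn: "(norm y)\<^sup>2 + (z ?n)\<^sup>2 = 1" using z(1) ye by (simp add: norm_sum)
      then have "(norm y)\<^sup>2 \<le> 1\<^sup>2" using zero_le_power2[of "z ?n"] unfolding one_power2 by linarith
      then have "norm y \<le> 1" by (rule power2_le_imp_le) simp
      then obtain x where x: "x \<in> topspace X" "\<pi> x = y" using \<pi>_image by (metis image_iff mem_cball_0)
      have "(f x)\<^sup>2 = (z ?n)\<^sup>2" using f_sq[OF x(1)] x(2) yn by simp
      then have "f x = z ?n \<or> f x = - z ?n" by (simp add: power2_eq_iff)
      moreover obtain t where t: "sg t = - 1" using sg_nontrivial by blast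
      have "f (act t x) = - f x"
        using \<sigma>_act[OF x(1)] \<pi>_act[OF x(1)] t by (simp add: f_def g_def)
      ultimately obtain x' where x': "x' \<in> topspace X" "\<pi> x' = y" "f x' = z ?n"
        using x \<pi>_act[OF x(1)] act_in[OF x(1)] by (metis minus_minus)
      have "\<Psi> x' = z"
      proof
        fix k
        show "\<Psi> x' k = z k" using ye z(2)[of k] x' by (simp add: \<Psi>_def)
      qed
      then show "z \<in> \<Psi> ` topspace X" using x'(1) by blast
    qed
  qed
  have fib: "action_orbit act {t. sg t = 1} x = action_orbit act {t. sg t = 1} y \<longleftrightarrow> \<Psi> x = \<Psi> y"
    if xy: "x \<in> topspace X" "y \<in> topspace X" for x y
    unfolding orbit_eq_iff[OF xy] \<Psi>_eq
  proof
    assume "\<exists>t. sg t = 1 \<and> y = act t x"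
    then obtain t where t: "sg t = 1" "y = act t x" by blast
    then show "\<pi> x = \<pi> y \<and> f x = f y"
      using \<sigma>_act[OF xy(1)] \<pi>_act[OF xy(1)] by (simp add: f_def g_def)
  next
    assume eq: "\<pi> x = \<pi> y \<and> f x = f y"
    then obtain t where t: "y = act t x" using \<pi>_fibre[OF xy] by blast
    show "\<exists>t. sg t = 1 \<and> y = act t x"
    proof (cases "norm (\<pi> x) < 1")
      case True
      have "f y = sg t * f x"
        using \<sigma>_act[OF xy(1) True] \<pi>_act[OF xy(1)] True t by (simp add: f_def g_def)
      moreover have "f x \<noteq> 0" using g_abs[OF xy(1)] g_pos[OF True] by auto
      ultimately have "sg t = 1" using eq by simp
      then show ?thesis using t by blast
    next
      case False
      then have "norm (\<pi> x) = 1" using norm_\<pi>[OF xy(1)] by simp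
      then obtain s where s: "sg s = - 1" "act s x = x" using boundary[OF xy(1)] by blast
      \<comment> \<open>Over the boundary, \<open>t\<close> may be corrected by an element that fixes \<open>x\<close>.\<close>
      have "y = act (t + s) x" using act_add[OF xy(1)] s t by simp
      moreover have "sg t = 1 \<or> sg (t + s) = 1" using sg_sign[of t] sg_add[of t s] s by auto
      ultimately show ?thesis using t by blast
    qed
  qed
  have "Hausdorff_space (nsphere ?n)"
    unfolding nsphere by (intro Hausdorff_space_subtopology) (simp add: Hausdorff_space_product_topology)
  then have "quotient_map X (nsphere ?n) \<Psi>"
    by (rule continuous_imp_quotient_map[OF cont compact_X _ surj])
  then show ?thesis
    using quotient_maps_same_fibres_homeomorphic[OF quotient_map_orbit_space] fib by blast
qed

end

lemma homeomorphism_convex_body_ball: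
  fixes P :: "'b::euclidean_space set"
  assumes "convex P" "compact P" "interior P \<noteq> {}"
  obtains k k' where "homeomorphism P (cball (0::'b) 1) k k'"
    and "\<And>q. q \<in> P \<Longrightarrow> norm (k q) < 1 \<longleftrightarrow> q \<in> interior P"
proof -
  have "P homeomorphic cball (0::'b) 1"
    using assms by (intro homeomorphic_convex_compact_cball) auto
  then obtain k k' where k: "homeomorphism P (cball (0::'b) 1) k k'" by (auto simp: homeomorphic_def)
  have inj: "inj_on k P" "inj_on k' (cball 0 1)"
    using k by (metis homeomorphism_def inj_on_inverseI)+
  have cont: "continuous_on P k" "continuous_on (cball 0 1) k'"
    and img: "k ` P = cball 0 1" "k' ` cball 0 1 = P" and kk: "\<And>q. q \<in> P \<Longrightarrow> k' (k q) = q"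
    using k by (auto simp: homeomorphism_def)
  have "open (k ` interior P)"
    by (rule invariance_of_domain[OF continuous_on_subset[OF cont(1) interior_subset] open_interior
          inj_on_subset[OF inj(1) interior_subset]])
  moreover have "k ` interior P \<subseteq> cball 0 1" using img interior_subset by blast
  ultimately have 1: "k ` interior P \<subseteq> ball 0 1" using interior_maximal by (metis interior_cball)
  have "open (k' ` ball 0 1)"
    by (rule invariance_of_domain[OF continuous_on_subset[OF cont(2) ball_subset_cball] open_ball
          inj_on_subset[OF inj(2) ball_subset_cball]])
  moreover have "k' ` ball 0 1 \<subseteq> P" using img ball_subset_cball by blast
  ultimately have 2: "k' ` ball 0 1 \<subseteq> interior P" by (metis interior_maximal)
  have "norm (k q) < 1 \<longleftrightarrow> q \<in> interior P" if "q \<in> P" for q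
  proof
    assume "norm (k q) < 1"
    then have "k' (k q) \<in> interior P" using 2 by (metis image_subset_iff mem_ball_0)
    then show "q \<in> interior P" using kk[OF that] by simp
  next
    assume "q \<in> interior P"
    then show "norm (k q) < 1" using 1 by (metis image_subset_iff mem_ball_0)
  qed
  with k show thesis by (rule that)
qed

theorem theorem3:
  fixes P :: "(real ^ 'n::finite) set"
    and X :: "'a topology"
    and A :: "('a, 'n) chart set"
    and act :: "bit ^ 'n \<Rightarrow> 'a \<Rightarrow> 'a"
    and G :: "(bit ^ 'n) set"
  assumes "simple_polytope P"
    and "small_cover P X A act"
    and "orientable X A"
    and "subtorus_in_general_position X A act G"
  shows "orbit_space X act G homeomorphic_space nsphere CARD('n)"
proof -
  obtain h where "diffeomorphism (orbit_space X act UNIV) (orbit_charts X A act)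
      (top_of_set P) (polytope_charts P) h"
    using assms(2) unfolding small_cover_def by blast
  then interpret small_cover_projection P X A act h
    using assms(1,2) by unfold_locales
  have conv: "convex P" "compact P" and aff: "affine hull P = UNIV" and ne: "P \<noteq> {}"
    using assms(1) polytope_imp_convex polytope_imp_compact aff_dim_eq_full[of P]
    by (auto simp: simple_polytope_def)
  have "interior P \<noteq> {}"
    using rel_interior_interior[OF aff] rel_interior_eq_empty[OF conv(1)] ne by simp
  then obtain k k' where k: "homeomorphism P (cball (0 :: real ^ 'n) 1) k k'"
    and k_int: "\<And>q. q \<in> P \<Longrightarrow> norm (k q) < 1 \<longleftrightarrow> q \<in> interior P"
    using homeomorphism_convex_body_ball[OF conv] by metis
  have inj_k: "inj_on k P" using k by (metis homeomorphism_def inj_on_inverseI)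
  define \<pi> where "\<pi> = k \<circ> p"
  have pP: "p x \<in> P" if "x \<in> topspace X" for x using p_image that by blast
  have \<pi>_int: "norm (\<pi> x) < 1 \<longleftrightarrow> p x \<in> interior P" if "x \<in> topspace X" for x
    using k_int[OF pP[OF that]] by (simp add: \<pi>_def)
  define sg :: "bit ^ 'n \<Rightarrow> real" where "sg t = (if t \<in> G then 1 else - 1)" for t
  have sub: "0 \<in> G" "\<And>s t. s \<in> G \<Longrightarrow> t \<in> G \<Longrightarrow> s + t \<in> G" "\<And>t. t \<in> G \<Longrightarrow> - t \<in> G"
    "card (range (\<lambda>a. (+) a ` G)) = 2"
    using assms(4) by (auto simp: subtorus_in_general_position_def)
  note index_two = index_two_add_mem[OF sub]
  have sg_sign: "sg t = 1 \<or> sg t = - 1" for t by (simp add: sg_def)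
  have sg_add: "sg (s + t) = sg s * sg t" for s t by (simp add: sg_def index_two(1))
  have sg_G: "{t. sg t = 1} = G" by (auto simp: sg_def)
  interpret folded: folded_ball X act sg \<pi>
  proof
    show "act t x \<in> topspace X" "act 0 x = x" "act (s + t) x = act s (act t x)"
      if "x \<in> topspace X" for s t x
      using act_in act_0 act_add that by auto
    show "sg t = 1 \<or> sg t = - 1" for t by (rule sg_sign)
    show "sg (s + t) = sg s * sg t" for s t by (rule sg_add)
    show "\<exists>t. sg t = - 1" using index_two(2) by (auto simp: sg_def)
    show "compact_space X" by (rule compact_X)
    have "continuous_map (top_of_set P) euclidean k" using k by (simp add: homeomorphism_def)
    with p_continuous show "continuous_map X euclidean \<pi>"
      unfolding \<pi>_def by (rule continuous_map_compose)
    show "\<pi> ` topspace X = cball 0 1"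
      unfolding \<pi>_def image_comp[symmetric] p_image using k by (simp add: homeomorphism_def)
    have "open_map (top_of_set P) (top_of_set (cball 0 1)) k"
      unfolding open_map_def using homeomorphism_imp_open_map[OF k] by blast
    with open_map_p show "open_map X (top_of_set (cball 0 1)) \<pi>"
      unfolding \<pi>_def by (rule open_map_compose)
    show "\<pi> x = \<pi> y \<longleftrightarrow> (\<exists>t. y = act t x)" if "x \<in> topspace X" "y \<in> topspace X" for x y
      using inj_on_eq_iff[OF inj_k pP[OF that(1)] pP[OF that(2)]] p_eq_iff[OF that]
      by (simp add: \<pi>_def)
    show "\<exists>t. sg t = - 1 \<and> act t x = x" if x: "x \<in> topspace X" and "norm (\<pi> x) = 1" for x
      using stabilizer_not_in_subtorus[OF assms(4) x] \<pi>_int[OF x] that(2) by (auto simp: sg_def)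
  qed
  have "\<exists>e>0. \<exists>\<sigma>. folded.sign_section (ball 0 1 \<inter> ball y e) \<sigma>" if y: "y \<in> ball 0 1" for y
  proof -
    have "y \<in> \<pi> ` topspace X" unfolding folded.\<pi>_image using y by auto
    then obtain x where x: "x \<in> topspace X" "\<pi> x = y" by blast
    obtain U \<sigma> where U: "openin X U" "x \<in> U"
      and cont: "continuous_map (subtopology X {z \<in> U. p z \<in> interior P}) euclideanreal \<sigma>"
      and \<sigma>: "\<And>z. \<sigma> z = 1 \<or> \<sigma> z = - 1" "\<And>z t. z \<in> U \<Longrightarrow> p z \<in> interior P \<Longrightarrow> \<sigma> (act t z) = sg t * \<sigma> z"
      and inv: "\<And>z t. z \<in> U \<Longrightarrow> act t z \<in> U"
      by (rule local_sign[of sg, OF sg_sign sg_add x(1)]) (rule that)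
    have "openin (top_of_set (cball 0 1)) (\<pi> ` U)"
      using folded.\<pi>_open U(1) by (simp add: open_map_def)
    then obtain W where W: "open W" "\<pi> ` U = cball 0 1 \<inter> W" by (auto simp: openin_open)
    have "y \<in> W" using W(2) U(2) x(2) by blast
    then obtain e where e: "e > 0" "ball y e \<subseteq> W" using W(1) open_contains_ball by blast
    have over: "folded.over (ball 0 1 \<inter> ball y e) \<subseteq> {z \<in> U. p z \<in> interior P}"
    proof
      fix z assume "z \<in> folded.over (ball 0 1 \<inter> ball y e)"
      then have z: "z \<in> topspace X" "norm (\<pi> z) < 1" "\<pi> z \<in> ball y e" by (auto simp: folded.over_def)
      then have "\<pi> z \<in> \<pi> ` U" unfolding W(2) using e(2) by auto
      then obtain u where u: "u \<in> U" "\<pi> u = \<pi> z" by (metis imageE)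
      then obtain t where "z = act t u"
        using folded.\<pi>_fibre[OF _ z(1)] openin_subset[OF U(1)] by blast
      then show "z \<in> {z \<in> U. p z \<in> interior P}" using inv[OF u(1)] \<pi>_int[OF z(1)] z(2) by blast
    qed
    have "continuous_map (subtopology X (folded.over (ball 0 1 \<inter> ball y e))) euclideanreal \<sigma>"
      by (rule continuous_map_from_subtopology_mono[OF cont over])
    then have "folded.sign_section (ball 0 1 \<inter> ball y e) \<sigma>"
      unfolding folded.sign_section_def using \<sigma> over by blast
    then show ?thesis using e(1) by blast
  qed
  then show ?thesis
    using folded.orbit_space_homeomorphic_nsphere by (simp add: sg_G)
qed

end
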